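(* Let $M$ be an $\infty$-definable submonoid of $M_2(\mathbb{C})$ (this includes the case that $M$ is definable), and write $M=H\cup S$ with $H=M\cap GL_2(\mathbb{C})$ and $S=M\cap M_2^0(\mathbb{C})$. Suppose $\pi(S)=B_{F,\{v\}}\cup B_{\{v\},G}$ for some $F,G\subseteq\mathbb{C}P^1$ and $v\in F\cap G$. Then $M$ is an intersection of definable submonoids of $M_2(\mathbb{C})$.
   Context: Work in the field $\mathbb{C}$ as a first-order structure in the language of rings $\{+,-,\cdot,0,1\}$. A subset of $\mathbb{C}^k$ is definable if it is defined by a first-order formula with parameters from $\mathbb{C}$ (equivalently, a constructible set), and $\infty$-definable if it is an intersection of (possibly infinitely many) definable sets. Matrices are identified with points of $\mathbb{C}^4$. $M_2^0(\mathbb{C})$ is the set of singular $2\times2$ complex matrices. $PM_2(\mathbb{C})=M_2(\mathbb{C})/\mathbb{C}^\times$ is the quotient monoid by nonzero scalars, with quotient homomorphism $\pi:M_2(\mathbb{C})\to PM_2(\mathbb{C})$; $PM_2^0(\mathbb{C})=\pi(M_2^0(\mathbb{C}))$. Each nonzero element of $PM_2^0(\mathbb{C})$ is $\pi(A)$ for a rank-one matrix $A$ and is identified with the pair $(v,u)\in(\mathbb{C}P^1)^2$ where $v$ is the image of $A$ and $u$ its kernel; the zero element is $0=\pi(0)$. For $F,G\subseteq \mathbb{C}P^1$, $B_{F,G}=\{(v,u): v\in F,\ u\in G\}\cup\{0\}$. A definable submonoid means a submonoid of $M_2(\mathbb{C})$ whose underlying set is definable.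
   Formalization: "∞-definable" is taken as an intersection of fewer than |ℂ| definable sets, and the conclusion gives such a small intersection; with unrestricted families every set is ∞-definable and the claim fails, e.g. for M = {2^n I : n ≥ 0} ∪ ℂE₁₂. *)

theory Defs
  imports
    "HOL-Analysis.Analysis"
    "HOL-Library.Equipollence"
    "HOL-Library.Set_Idioms"
    "HOL-Algebra.Group"
begin

text \<open>First-order formulas in the language of rings, with parameters from \<^typ>\<open>complex\<close>.
  Variables (free and bound) are named by natural numbers.\<close>

datatype ring_term =
    Var nat
  | Param complex
  | Zero
  | One
  | Neg ring_term
  | Add ring_term ring_term
  | Mul ring_term ring_term

datatype ring_fm =
    Eq ring_term ring_term
  | NOT ring_fm
  | And ring_fm ring_fm
  | Exists nat ring_fm

primrec tm_vars :: "ring_term \<Rightarrow> nat set" where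
  "tm_vars (Var i) = {i}"
| "tm_vars (Param c) = {}"
| "tm_vars Zero = {}"
| "tm_vars One = {}"
| "tm_vars (Neg s) = tm_vars s"
| "tm_vars (Add s t) = tm_vars s \<union> tm_vars t"
| "tm_vars (Mul s t) = tm_vars s \<union> tm_vars t"

primrec free_vars :: "ring_fm \<Rightarrow> nat set" where
  "free_vars (Eq s t) = tm_vars s \<union> tm_vars t"
| "free_vars (NOT p) = free_vars p"
| "free_vars (And p q) = free_vars p \<union> free_vars q"
| "free_vars (Exists i p) = free_vars p - {i}"

primrec tm_val :: "(nat \<Rightarrow> complex) \<Rightarrow> ring_term \<Rightarrow> complex" where
  "tm_val e (Var i) = e i"
| "tm_val e (Param c) = c"
| "tm_val e Zero = 0"
| "tm_val e One = 1"
| "tm_val e (Neg s) = - tm_val e s"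
| "tm_val e (Add s t) = tm_val e s + tm_val e t"
| "tm_val e (Mul s t) = tm_val e s * tm_val e t"

primrec sat :: "(nat \<Rightarrow> complex) \<Rightarrow> ring_fm \<Rightarrow> bool" where
  "sat e (Eq s t) \<longleftrightarrow> tm_val e s = tm_val e t"
| "sat e (NOT p) \<longleftrightarrow> \<not> sat e p"
| "sat e (And p q) \<longleftrightarrow> sat e p \<and> sat e q"
| "sat e (Exists i p) \<longleftrightarrow> (\<exists>c. sat (e(i := c)) p)"

text \<open>A point of \<open>\<complex>\<^sup>k\<close> is a list of length \<open>k\<close>.  The values \<open>xs ! i\<close> with \<open>i \<ge> k\<close>
  are irrelevant because of the condition on the free variables.\<close>

definition definable :: "nat \<Rightarrow> complex list set \<Rightarrow> bool" where
  "definable k X \<longleftrightarrow>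
     (\<exists>p. free_vars p \<subseteq> {..<k} \<and> X = {xs. length xs = k \<and> sat (\<lambda>i. xs ! i) p})"

definition entries :: "complex^2^2 \<Rightarrow> complex list" where
  "entries A = [A $ 1 $ 1, A $ 1 $ 2, A $ 2 $ 1, A $ 2 $ 2]"

definition definable_mat :: "(complex^2^2) set \<Rightarrow> bool" where
  "definable_mat X \<longleftrightarrow> definable 4 (entries ` X)"

text \<open>Infinite intersections of definable sets are taken, as usual in model theory, over families
  that are small with respect to the saturation of the structure: the field \<open>\<complex>\<close> is saturated
  in its own cardinality.  Without a bound on the family every set would be an intersection of
  definable sets, namely of complements of points.\<close>

definition small :: "(complex^2^2) set set \<Rightarrow> bool" where
  "small \<U> \<longleftrightarrow> \<U> \<prec> (UNIV :: complex set)"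

definition infty_definable_mat :: "(complex^2^2) set \<Rightarrow> bool" where
  "infty_definable_mat = small intersection_of definable_mat"

definition M2 :: "(complex^2^2) monoid" where
  "M2 = \<lparr>carrier = UNIV, mult = (**), one = mat 1\<rparr>"

lemma monoid_M2: "monoid M2"
  by unfold_locales (auto simp: M2_def matrix_mul_assoc)

definition GL2 :: "(complex^2^2) set" where
  "GL2 = {A. invertible A}"

definition M2_0 :: "(complex^2^2) set" where
  "M2_0 = {A. \<not> invertible A}"

text \<open>The elements of \<open>PM\<^sub>2(\<complex>) = M\<^sub>2(\<complex>) / \<complex>\<^sup>\<times>\<close> are the orbits of the nonzero scalars, and
  \<open>proj\<close> is the quotient map \<open>\<pi>\<close>.\<close>

definition proj :: "complex^2^2 \<Rightarrow> (complex^2^2) set" where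
  "proj A = {map_matrix ((*) c) A | c. c \<noteq> 0}"

definition CP1 :: "(complex^2) set set" where
  "CP1 = {L. vec.subspace L \<and> vec.dim L = 1}"

definition image_of :: "complex^2^2 \<Rightarrow> (complex^2) set" where
  "image_of A = range ((*v) A)"

definition kernel_of :: "complex^2^2 \<Rightarrow> (complex^2) set" where
  "kernel_of A = {x. A *v x = 0}"

text \<open>The pair \<open>(v, u)\<close> stands for \<open>\<pi>(A)\<close>, where \<open>A\<close> is a rank-one matrix with image \<open>v\<close> and
  kernel \<open>u\<close>.\<close>

definition B_set :: "(complex^2) set set \<Rightarrow> (complex^2) set set \<Rightarrow> (complex^2^2) set set" where
  "B_set F G = {proj A | A. rank A = 1 \<and> image_of A \<in> F \<and> kernel_of A \<in> G} \<union> {proj 0}"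

end

theory Submission
  imports
    Defs
    "HOL-Computational_Algebra.Fundamental_Theorem_Algebra"
    "HOL-Algebra.Free_Abelian_Groups"
begin

text \<open>The hypothesis on \<open>\<pi>(S)\<close> forces every element of \<open>M\<close> to preserve the line \<open>v\<close>, so in a suitable
  basis \<open>M\<close> is a monoid of upper triangular matrices which contains \<open>0\<close> and a nonzero nilpotent.
  It suffices to interpolate a definable monoid between \<open>M\<close> and each definable \<open>U \<supseteq> M\<close>.

  By quantifier elimination definable subsets of \<open>\<complex>\<close> are finite or cofinite, so an \<open>\<infinity>\<close>-definable
  subset of \<open>\<complex>\<close> is finite or has a small complement; in particular an \<open>\<infinity>\<close>-definable submonoid of
  \<open>\<complex>\<^sup>\<times>\<close> is a finite group or everything, and one of \<open>(\<complex>, +)\<close> is trivial or everything.  Projecting to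
  the diagonal entries one at a time, and using saturation to uniformize finite fibres, one finds that
  \<open>H\<close> is definable.

  The set \<open>S\<close> consists of the nilpotents, the rank-one matrices with image \<open>v\<close> and those with kernel
  \<open>v\<close>.  Each piece \<open>Z\<close> is replaced by the definable set of all matrices whose orbit, under the
  definable group acting on \<open>Z\<close>, stays in \<open>U\<close>.  The remaining constraint is that products of the two
  rank-one pieces land in the nilpotent piece.  It is void if all nilpotents occur; otherwise one of the
  rank-one pieces is finite, is kept as it is, and the constraint is added to the definition of the
  other.\<close>

section \<open>Polynomial functions and constructible predicates\<close>

text \<open>Environments have infinitely many coordinates, so no arity has to be tracked and a
  quantifier can simply shift the indices. Each polynomial function still depends on finitely many
  of them.\<close>

inductive polyfun :: "((nat \<Rightarrow> complex) \<Rightarrow> complex) \<Rightarrow> bool" where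
  polyfun_const: "polyfun (\<lambda>e. c)"
| polyfun_var: "polyfun (\<lambda>e. e i)"
| polyfun_add: "polyfun f \<Longrightarrow> polyfun g \<Longrightarrow> polyfun (\<lambda>e. f e + g e)"
| polyfun_mult: "polyfun f \<Longrightarrow> polyfun g \<Longrightarrow> polyfun (\<lambda>e. f e * g e)"

lemma polyfun_uminus: "polyfun f \<Longrightarrow> polyfun (\<lambda>e. - f e)"
  using polyfun_mult[OF polyfun_const[of "-1"]] by simp

lemma polyfun_diff: "polyfun f \<Longrightarrow> polyfun g \<Longrightarrow> polyfun (\<lambda>e. f e - g e)"
  using polyfun_add[OF _ polyfun_uminus] by simp

lemma polyfun_sum: "(\<And>i. i \<in> I \<Longrightarrow> polyfun (f i)) \<Longrightarrow> polyfun (\<lambda>e. \<Sum>i\<in>I. f i e)"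
  by (induction I rule: infinite_finite_induct) (auto intro: polyfun_const polyfun_add)

lemma polyfun_subst:
  assumes "polyfun f" and "\<And>i. polyfun (g i)"
  shows "polyfun (\<lambda>e. f (\<lambda>i. g i e))"
  using assms(1) by induction (auto intro: assms(2) polyfun.intros)

text \<open>The semantic counterpart of quantifier-free formulas with parameters. Quantifier
  elimination then says that this class is closed under projection.\<close>

inductive constructible :: "((nat \<Rightarrow> complex) \<Rightarrow> bool) \<Rightarrow> bool" where
  constructible_zero: "polyfun f \<Longrightarrow> constructible (\<lambda>e. f e = 0)"
| constructible_not: "constructible P \<Longrightarrow> constructible (\<lambda>e. \<not> P e)"
| constructible_and: "constructible P \<Longrightarrow> constructible Q \<Longrightarrow> constructible (\<lambda>e. P e \<and> Q e)"

lemma constructible_subst: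
  assumes "constructible P" and "\<And>i. polyfun (g i)"
  shows "constructible (\<lambda>e. P (\<lambda>i. g i e))"
  using assms(1)
  by induction (auto intro: constructible_zero[OF polyfun_subst[OF _ assms(2)]] constructible_not constructible_and)

lemma constructible_or:
  assumes "constructible P" "constructible Q"
  shows "constructible (\<lambda>e. P e \<or> Q e)"
proof -
  have "constructible (\<lambda>e. \<not> (\<not> P e \<and> \<not> Q e))"
    by (intro constructible_not constructible_and assms)
  then show ?thesis by simp
qed

lemma constructible_imp:
  assumes "constructible P" "constructible Q"
  shows "constructible (\<lambda>e. P e \<longrightarrow> Q e)"
proof -
  have "constructible (\<lambda>e. \<not> P e \<or> Q e)"
    by (intro constructible_or constructible_not assms)
  then show ?thesis by (simp only: imp_conv_disj)
qed

lemma constructible_eq: "polyfun f \<Longrightarrow> polyfun g \<Longrightarrow> constructible (\<lambda>e. f e = g e)"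
  using constructible_zero[OF polyfun_diff, of f g] by simp

lemma constructible_bool: "constructible (\<lambda>e. b)"
  using constructible_zero[OF polyfun_const[of "if b then 0 else 1"]] by (cases b) auto

lemma constructible_Ball_finite:
  assumes "finite I" and "\<And>i. i \<in> I \<Longrightarrow> constructible (P i)"
  shows "constructible (\<lambda>e. \<forall>i\<in>I. P i e)"
  using assms by (induction I) (auto intro: constructible_bool constructible_and)

lemma constructible_Bex_finite:
  assumes "finite I" and "\<And>i. i \<in> I \<Longrightarrow> constructible (P i)"
  shows "constructible (\<lambda>e. \<exists>i\<in>I. P i e)"
  using assms by (induction I) (auto intro: constructible_bool constructible_or)

text \<open>Allows an elimination step to treat a vanishing and a nonvanishing leading coefficient
  separately.\<close>

lemma constructible_cases:
  assumes "constructible C" "constructible P" "constructible Q"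
    and "\<And>e. C e \<Longrightarrow> R e = P e" and "\<And>e. \<not> C e \<Longrightarrow> R e = Q e"
  shows "constructible R"
proof -
  have "R = (\<lambda>e. (C e \<and> P e) \<or> (\<not> C e \<and> Q e))"
    using assms(4,5) by auto
  then show ?thesis
    using assms(1-3) by (metis constructible_or constructible_and constructible_not)
qed

section \<open>Elimination of one quantifier\<close>

text \<open>The bound \<open>n\<close> is formal: it is strict and uniform in the parameters, while
  the true degree of \<open>F e\<close> may be smaller for special \<open>e\<close>. All inductions
  of the elimination run over such bounds.\<close>

definition ppoly :: "nat \<Rightarrow> ((nat \<Rightarrow> complex) \<Rightarrow> complex poly) \<Rightarrow> bool" where
  "ppoly n F \<longleftrightarrow> (\<forall>j. polyfun (\<lambda>e. coeff (F e) j)) \<and> (\<forall>e j. n \<le> j \<longrightarrow> coeff (F e) j = 0)"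

lemma ppoly_coeff: "ppoly n F \<Longrightarrow> polyfun (\<lambda>e. coeff (F e) j)"
  by (simp add: ppoly_def)

lemma ppoly_coeff_0: "ppoly n F \<Longrightarrow> n \<le> j \<Longrightarrow> coeff (F e) j = 0"
  by (simp add: ppoly_def)

lemma ppoly_0: "ppoly 0 F \<Longrightarrow> F e = 0"
  by (simp add: ppoly_def poly_eq_iff)

lemma ppoly_const: "polyfun f \<Longrightarrow> ppoly 1 (\<lambda>e. [:f e:])"
  unfolding ppoly_def
proof (intro conjI allI impI)
  show "polyfun (\<lambda>e. coeff [:f e:] j)" if "polyfun f" for j
    using that by (cases j) (auto intro: polyfun_const)
qed (auto simp: coeff_pCons split: nat.split)

lemma ppoly_X: "ppoly 2 (\<lambda>e. [:0, 1:])"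
  unfolding ppoly_def by (auto simp: coeff_pCons split: nat.split intro: polyfun_const)

lemma ppoly_add: "ppoly n F \<Longrightarrow> ppoly m G \<Longrightarrow> ppoly (max n m) (\<lambda>e. F e + G e)"
  unfolding ppoly_def by (auto intro: polyfun_add)

lemma ppoly_mult:
  assumes "ppoly n F" "ppoly m G"
  shows "ppoly (n + m) (\<lambda>e. F e * G e)"
  unfolding ppoly_def
proof (intro conjI allI impI)
  show "polyfun (\<lambda>e. coeff (F e * G e) j)" for j
    unfolding coeff_mult
    by (intro polyfun_sum polyfun_mult ppoly_coeff[OF assms(1)] ppoly_coeff[OF assms(2)])
  show "coeff (F e * G e) j = 0" if "n + m \<le> j" for e j
    unfolding coeff_mult
  proof (intro sum.neutral ballI)
    fix i assume "i \<in> {..j}"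
    then have "n \<le> i \<or> m \<le> j - i" using that by auto
    then show "coeff (F e) i * coeff (G e) (j - i) = 0"
      using assms by (auto simp: ppoly_coeff_0)
  qed
qed

lemma ppoly_power: "ppoly n F \<Longrightarrow> \<exists>m. ppoly m (\<lambda>e. F e ^ k)"
proof (induction k)
  case 0
  show ?case using ppoly_const[OF polyfun_const[of 1]] by (auto simp: one_pCons)
next
  case (Suc k)
  then show ?case using ppoly_mult[OF Suc.prems] by force
qed

text \<open>Pseudo-division: scaling \<open>B\<close> by the leading coefficient of \<open>F\<close>
  instead of dividing by it keeps the coefficients polynomial in the parameters, and the terms of
  degree \<open>m\<close> cancel.\<close>

lemma ppoly_pseudo_step:
  assumes F: "ppoly (Suc d) F" and B: "ppoly (Suc m) B" and "d \<le> m"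
  shows "ppoly m (\<lambda>e. smult (coeff (F e) d) (B e) - monom (coeff (B e) m) (m - d) * F e)"
  unfolding ppoly_def
proof (intro conjI allI impI)
  fix j
  show "polyfun (\<lambda>e. coeff (smult (coeff (F e) d) (B e) - monom (coeff (B e) m) (m - d) * F e) j)"
    by (cases "j < m - d")
      (auto simp: coeff_monom_mult intro!: polyfun_diff polyfun_mult polyfun_const ppoly_coeff[OF F] ppoly_coeff[OF B])
  fix e
  assume "m \<le> j"
  then have "j = m \<or> Suc m \<le> j" by auto
  then show "coeff (smult (coeff (F e) d) (B e) - monom (coeff (B e) m) (m - d) * F e) j = 0"
    using \<open>d \<le> m\<close> ppoly_coeff_0[OF F] ppoly_coeff_0[OF B] by (auto simp: coeff_monom_mult)
qed

text \<open>Where the coefficient of degree \<open>d\<close> vanishes nothing is removed, so there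
  the formal bound drops for the same polynomial.\<close>

lemma ppoly_drop_lead:
  assumes F: "ppoly (Suc d) F"
  shows "ppoly d (\<lambda>e. F e - monom (coeff (F e) d) d)"
  unfolding ppoly_def
proof (intro conjI allI impI)
  show "polyfun (\<lambda>e. coeff (F e - monom (coeff (F e) d) d) j)" for j
    by (cases "j = d") (auto intro: polyfun_const ppoly_coeff[OF F])
  show "coeff (F e - monom (coeff (F e) d) d) j = 0" if "d \<le> j" for j e
    using that ppoly_coeff_0[OF F, of j e] by (cases "j = d") auto
qed

lemma constructible_ppoly_eq_0:
  assumes "ppoly n F"
  shows "constructible (\<lambda>e. F e = 0)"
proof -
  have "(\<lambda>e. F e = 0) = (\<lambda>e. \<forall>j\<in>{..<n}. coeff (F e) j = 0)"
  proof
    show "F e = 0 \<longleftrightarrow> (\<forall>j\<in>{..<n}. coeff (F e) j = 0)" for e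
      using ppoly_coeff_0[OF assms] by (metis coeff_0 lessThan_iff not_le poly_eqI)
  qed
  then show ?thesis
    using constructible_Ball_finite[of "{..<n}"] constructible_zero[OF ppoly_coeff[OF assms]] by simp
qed

text \<open>A nonzero leading coefficient is a unit, so a pseudo-division step does not affect
  divisibility by \<open>F e\<close>. Once the bound of the dividend is at most \<open>d\<close>,
  divisibility means being zero.\<close>

lemma constructible_ppoly_dvd:
  assumes F: "ppoly (Suc d) F" and "ppoly m B"
  shows "\<exists>P. constructible P \<and> (\<forall>e. coeff (F e) d \<noteq> 0 \<longrightarrow> (P e \<longleftrightarrow> F e dvd B e))"
  using assms(2)
proof (induction m arbitrary: B)
  case 0
  have "B e = 0" for e using ppoly_0[OF 0] .
  then show ?case using constructible_bool[of True] by auto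
next
  case (Suc m)
  show ?case
  proof (cases "d \<le> m")
    case True
    obtain P where P: "constructible P" "\<And>e. coeff (F e) d \<noteq> 0 \<Longrightarrow> P e \<longleftrightarrow>
        F e dvd smult (coeff (F e) d) (B e) - monom (coeff (B e) m) (m - d) * F e"
      using Suc.IH[OF ppoly_pseudo_step[OF F Suc.prems True]] by auto
    have "P e \<longleftrightarrow> F e dvd B e" if "coeff (F e) d \<noteq> 0" for e
      using P(2)[OF that] that dvd_smult_iff by (simp add: dvd_diff_left_iff)
    then show ?thesis using P(1) by blast
  next
    case False
    have "B e = 0 \<longleftrightarrow> F e dvd B e" if "coeff (F e) d \<noteq> 0" for e
    proof
      assume "F e dvd B e"
      show "B e = 0"
      proof (rule ccontr)
        assume "B e \<noteq> 0"
        have "d \<le> degree (F e)" using that by (rule le_degree)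
        also have "\<dots> \<le> degree (B e)" using \<open>F e dvd B e\<close> \<open>B e \<noteq> 0\<close> by (rule dvd_imp_degree_le)
        finally have "Suc m \<le> degree (B e)" using False by simp
        then show False using ppoly_coeff_0[OF Suc.prems] \<open>B e \<noteq> 0\<close> leading_coeff_0_iff by blast
      qed
    qed simp
    then show ?thesis using constructible_ppoly_eq_0[OF Suc.prems] by blast
  qed
qed

text \<open>Over an algebraically closed field all roots of a polynomial \<open>F\<close> of degree
  \<open>d\<close> are roots of \<open>G\<close> iff \<open>F\<close> divides \<open>G ^ d\<close>,
  because no root of \<open>F\<close> has multiplicity above \<open>d\<close>.\<close>

lemma constructible_ex_root_nonroot:
  assumes F: "ppoly (Suc d) F" and G: "ppoly m G"
  shows "\<exists>P. constructible P \<and>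
    (\<forall>e. coeff (F e) d \<noteq> 0 \<longrightarrow> (P e \<longleftrightarrow> (\<exists>c. poly (F e) c = 0 \<and> poly (G e) c \<noteq> 0)))"
proof -
  obtain k where k: "ppoly k (\<lambda>e. G e ^ d)" using ppoly_power[OF G] by blast
  obtain P where P: "constructible P" "\<And>e. coeff (F e) d \<noteq> 0 \<Longrightarrow> P e \<longleftrightarrow> F e dvd G e ^ d"
    using constructible_ppoly_dvd[OF F k] by auto
  have "(\<exists>c. poly (F e) c = 0 \<and> poly (G e) c \<noteq> 0) \<longleftrightarrow> \<not> P e" if nz: "coeff (F e) d \<noteq> 0" for e
  proof -
    have "degree (F e) = d"
      using le_degree[OF nz] ppoly_coeff_0[OF F, of _ e] leading_coeff_0_iff[of "F e"] nz
      by (metis coeff_0 le_antisym not_less_eq_eq)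
    moreover have "F e \<noteq> 0" using nz by auto
    ultimately show ?thesis
      using nullstellensatz_univariate[of "F e" "G e"] P(2)[OF nz] by auto
  qed
  then show ?thesis using constructible_not[OF P(1)] by blast
qed

text \<open>A parametric Euclidean algorithm: as long as two equations remain, one of them is
  replaced by a pseudo-remainder or loses its vanishing leading term. A single equation is settled
  by divisibility.\<close>

lemma constructible_ex_system:
  assumes "\<forall>(n, F) \<in> set fs. ppoly n F" and G: "ppoly m G"
  shows "constructible (\<lambda>e. \<exists>c. (\<forall>(n, F) \<in> set fs. poly (F e) c = 0) \<and> poly (G e) c \<noteq> 0)"
  using assms(1)
\<comment> \<open>Each equation counts \<open>Suc n\<close> rather than \<open>n\<close>, so that
  deleting an equation of bound \<open>0\<close> also decreases the measure.\<close>
proof (induction "\<Sum>(n, F)\<leftarrow>fs. Suc n" arbitrary: fs rule: less_induct)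
  case less
  define sys :: "_ \<Rightarrow> _ \<Rightarrow> _ \<Rightarrow> bool"
    where "sys fs e c = (\<forall>(n, F) \<in> set fs. poly (F e) c = 0)"
    for fs :: "(nat \<times> ((nat \<Rightarrow> complex) \<Rightarrow> complex poly)) list" and e c
  have IH: "constructible (\<lambda>e. \<exists>c. sys gs e c \<and> poly (G e) c \<noteq> 0)"
    if "(\<Sum>(n, F)\<leftarrow>gs. Suc n) < (\<Sum>(n, F)\<leftarrow>fs. Suc n)" "\<forall>(n, F) \<in> set gs. ppoly n F" for gs
    using less.hyps[OF that] by (simp add: sys_def)
  \<comment> \<open>Where the leading coefficient of \<open>F\<close> is nonzero, subtracting a
    multiple of \<open>F\<close> from a multiple of \<open>F'\<close> preserves the common roots.
    The list is given up to order, so the step can be applied with either equation as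
    divisor.\<close>
  have reduce: "constructible (\<lambda>e. \<exists>c. sys fs e c \<and> poly (G e) c \<noteq> 0)"
    if fs: "mset fs = mset ((Suc d, F) # (Suc k, F') # rest)" and "d \<le> k" for d k F F' rest
  proof -
    have set_fs: "set fs = set ((Suc d, F) # (Suc k, F') # rest)" using fs mset_eq_setD by blast
    have F: "ppoly (Suc d) F" and F': "ppoly (Suc k) F'" and rest: "\<forall>(n, F) \<in> set rest. ppoly n F"
      using less.prems unfolding set_fs by auto
    have size: "(\<Sum>(n, F)\<leftarrow>fs. Suc n) = (\<Sum>(n, F)\<leftarrow>(Suc d, F) # (Suc k, F') # rest. Suc n)"
    proof -
      have "mset (map (\<lambda>(n, F). Suc n) fs) = mset (map (\<lambda>(n, F). Suc n) ((Suc d, F) # (Suc k, F') # rest))"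
        using fs by simp
      then show ?thesis by (metis sum_mset_sum_list)
    qed
    define R where "R = (\<lambda>e. smult (coeff (F e) d) (F' e) - monom (coeff (F' e) k) (k - d) * F e)"
    define D where "D = (\<lambda>e. F e - monom (coeff (F e) d) d)"
    have R: "ppoly k R" unfolding R_def by (rule ppoly_pseudo_step[OF F F' \<open>d \<le> k\<close>])
    have D: "ppoly d D" unfolding D_def by (rule ppoly_drop_lead[OF F])
    show ?thesis
    proof (rule constructible_cases)
      show "constructible (\<lambda>e. coeff (F e) d = 0)"
        by (intro constructible_zero ppoly_coeff[OF F])
      show "constructible (\<lambda>e. \<exists>c. sys ((d, D) # (Suc k, F') # rest) e c \<and> poly (G e) c \<noteq> 0)"
        using D F' rest by (intro IH) (auto simp: size)
      show "constructible (\<lambda>e. \<exists>c. sys ((Suc d, F) # (k, R) # rest) e c \<and> poly (G e) c \<noteq> 0)"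
        using R F rest by (intro IH) (auto simp: size)
    qed (auto simp: sys_def set_fs R_def D_def)
  qed
  have "constructible (\<lambda>e. \<exists>c. sys fs e c \<and> poly (G e) c \<noteq> 0)"
  proof (cases "\<exists>F. (0, F) \<in> set fs")
    case True
    then obtain F where F: "(0, F) \<in> set fs" by blast
    then have "F e = 0" for e using less.prems ppoly_0 by fastforce
    have "sys fs = sys (remove1 (0, F) fs)"
    proof (intro ext iffI)
      fix e c
      show "sys (remove1 (0, F) fs) e c" if "sys fs e c"
        using that set_remove1_subset unfolding sys_def by fast
      assume rem: "sys (remove1 (0, F) fs) e c"
      have "poly (F' e) c = 0" if "(n, F') \<in> set fs" for n F'
      proof (cases "(n, F') = (0, F)")
        case False
        then have "(n, F') \<in> set (remove1 (0, F) fs)" using that by (simp add: in_set_remove1)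
        then show ?thesis using rem unfolding sys_def by fast
      qed (use \<open>\<And>e. F e = 0\<close> in simp)
      then show "sys fs e c" unfolding sys_def by fast
    qed
    moreover have "(\<Sum>(n, F)\<leftarrow>remove1 (0, F) fs. Suc n) < (\<Sum>(n, F)\<leftarrow>fs. Suc n)"
      using sum_list_map_remove1[OF F, of "\<lambda>(n, F). Suc n"] by simp
    moreover have "\<forall>(n, F) \<in> set (remove1 (0, F) fs). ppoly n F"
      using less.prems set_remove1_subset by fast
    ultimately show ?thesis using IH by simp
  next
    case False
    then have pos: "\<exists>d. n = Suc d" if "(n, F) \<in> set fs" for n F using that by (cases n) auto
    consider "fs = []" | n F where "fs = [(n, F)]" | n F n' F' rest where "fs = (n, F) # (n', F') # rest"
      by (metis list.exhaust surj_pair)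
    then show ?thesis
    proof cases
      case 1
      \<comment> \<open>Without equations a witness exists unless \<open>G e\<close> is the zero
        polynomial, since the field is infinite.\<close>
      have "(\<lambda>e. \<exists>c. sys fs e c \<and> poly (G e) c \<noteq> 0) = (\<lambda>e. \<not> G e = 0)"
        by (simp add: sys_def 1 poly_all_0_iff_0[symmetric])
      then show ?thesis using constructible_not[OF constructible_ppoly_eq_0[OF G]] by simp
    next
      case (2 n F)
      then obtain d where d: "fs = [(Suc d, F)]" using pos by fastforce
      then have F: "ppoly (Suc d) F" using less.prems by auto
      obtain P where P: "constructible P" "\<And>e. coeff (F e) d \<noteq> 0 \<Longrightarrow>
          P e \<longleftrightarrow> (\<exists>c. poly (F e) c = 0 \<and> poly (G e) c \<noteq> 0)"
        using constructible_ex_root_nonroot[OF F G] by auto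
      define D where "D = (\<lambda>e. F e - monom (coeff (F e) d) d)"
      show ?thesis
      proof (rule constructible_cases)
        show "constructible (\<lambda>e. coeff (F e) d = 0)"
          by (intro constructible_zero ppoly_coeff[OF F])
        show "constructible (\<lambda>e. \<exists>c. sys [(d, D)] e c \<and> poly (G e) c \<noteq> 0)"
          using ppoly_drop_lead[OF F] by (intro IH) (auto simp: d D_def)
        show "constructible P" by (rule P)
      qed (use P in \<open>auto simp: sys_def d D_def\<close>)
    next
      case (3 n F n' F' rest)
      then obtain d d' where "n = Suc d" "n' = Suc d'" using pos by fastforce
      then show ?thesis
        using reduce[of d F d' F' rest] reduce[of d' F' d F rest] by (cases "d \<le> d'") (auto simp: 3)
    qed
  qed
  then show ?case by (simp add: sys_def)
qed

section \<open>Disjunctive normal forms and elimination of an arbitrary existential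
  quantifier\<close>

inductive dnf :: "((nat \<Rightarrow> complex) \<Rightarrow> bool) \<Rightarrow> bool" where
  dnf_basic: "\<forall>f \<in> set fs. polyfun f \<Longrightarrow> polyfun g \<Longrightarrow> dnf (\<lambda>e. (\<forall>f \<in> set fs. f e = 0) \<and> g e \<noteq> 0)"
| dnf_or: "dnf P \<Longrightarrow> dnf Q \<Longrightarrow> dnf (\<lambda>e. P e \<or> Q e)"

text \<open>Conjunction distributes over disjunction, and two inequations merge into one by
  multiplying them; hence one inequation per basic conjunct is enough.\<close>

lemma dnf_and:
  assumes "dnf P" "dnf Q"
  shows "dnf (\<lambda>e. P e \<and> Q e)"
  using assms
proof (induction arbitrary: Q rule: dnf.induct)
  case (dnf_basic fs g)
  from dnf_basic(3,1,2) show ?case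
  proof (induction rule: dnf.induct)
    case (dnf_basic fs' g')
    have "dnf (\<lambda>e. (\<forall>f \<in> set (fs @ fs'). f e = 0) \<and> g e * g' e \<noteq> 0)"
      using dnf_basic by (intro dnf.dnf_basic polyfun_mult) auto
    then show ?case by (rule back_subst[of dnf]) auto
  next
    case (dnf_or P Q)
    have "dnf (\<lambda>e. ((\<forall>f \<in> set fs. f e = 0) \<and> g e \<noteq> 0) \<and> P e \<or> ((\<forall>f \<in> set fs. f e = 0) \<and> g e \<noteq> 0) \<and> Q e)"
      using dnf_or by (intro dnf.dnf_or) auto
    then show ?case by (rule back_subst[of dnf]) auto
  qed
next
  case (dnf_or P P')
  have "dnf (\<lambda>e. P e \<and> Q e \<or> P' e \<and> Q e)" using dnf_or by (intro dnf.dnf_or) auto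
  then show ?case by (rule back_subst[of dnf]) auto
qed

lemma constructible_imp_dnf: "constructible P \<Longrightarrow> dnf P \<and> dnf (\<lambda>e. \<not> P e)"
proof (induction rule: constructible.induct)
  case (constructible_zero f)
  have "dnf (\<lambda>e. (\<forall>f \<in> set [f]. f e = 0) \<and> (1::complex) \<noteq> 0)"
    using constructible_zero by (intro dnf_basic polyfun_const) auto
  moreover have "dnf (\<lambda>e. f e \<noteq> 0)"
    using dnf_basic[of "[]" f] constructible_zero by simp
  ultimately show ?case by simp
next
  case (constructible_and P Q)
  then have "dnf (\<lambda>e. \<not> P e \<or> \<not> Q e)" by (intro dnf_or) auto
  then show ?case using constructible_and dnf_and by simp
qed simp

text \<open>Coordinate \<open>0\<close> is singled out as the variable of a univariate polynomial,
  with coefficients in the remaining coordinates.\<close>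

lemma polyfun_case_nat:
  assumes "polyfun f"
  shows "\<exists>n F. ppoly n F \<and> (\<forall>e c. f (case_nat c e) = poly (F e) c)"
  using assms
proof induction
  case (polyfun_const c)
  show ?case using ppoly_const[OF polyfun.polyfun_const] by (intro exI[of _ 1] exI[of _ "\<lambda>e. [:c:]"]) simp
next
  case (polyfun_var i)
  show ?case
  proof (cases i)
    case 0
    then show ?thesis using ppoly_X by (intro exI[of _ 2] exI[of _ "\<lambda>e. [:0, 1:]"]) simp
  next
    case (Suc j)
    then show ?thesis using ppoly_const[OF polyfun.polyfun_var]
      by (intro exI[of _ 1] exI[of _ "\<lambda>e. [:e j:]"]) simp
  qed
next
  case (polyfun_add f g)
  then obtain n F m G where "ppoly n F" "ppoly m G"
    "\<And>e c. f (case_nat c e) = poly (F e) c" "\<And>e c. g (case_nat c e) = poly (G e) c" by blast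
  then show ?case
    using ppoly_add[of n F m G] by (intro exI[of _ "max n m"] exI[of _ "\<lambda>e. F e + G e"]) simp
next
  case (polyfun_mult f g)
  then obtain n F m G where "ppoly n F" "ppoly m G"
    "\<And>e c. f (case_nat c e) = poly (F e) c" "\<And>e c. g (case_nat c e) = poly (G e) c" by blast
  then show ?case
    using ppoly_mult[of n F m G] by (intro exI[of _ "n + m"] exI[of _ "\<lambda>e. F e * G e"]) simp
qed

lemma constructible_ex_case_nat:
  assumes "constructible P"
  shows "constructible (\<lambda>e. \<exists>c. P (case_nat c e))"
proof -
  have "dnf P" using constructible_imp_dnf[OF assms] by simp
  then show ?thesis
  proof induction
    case (dnf_basic fs g)
    define r where "r f = (SOME (n, F). ppoly n F \<and> (\<forall>e c. f (case_nat c e) = poly (F e) c))" for f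
    have r: "case r f of (n, F) \<Rightarrow> ppoly n F \<and> (\<forall>e c. f (case_nat c e) = poly (F e) c)"
      if "polyfun f" for f
    proof -
      have "\<exists>x. case x of (n, F) \<Rightarrow> ppoly n F \<and> (\<forall>e c. f (case_nat c e) = poly (F e) c)"
        using polyfun_case_nat[OF that] by auto
      then show ?thesis unfolding r_def by (rule someI_ex)
    qed
    obtain m G where G: "r g = (m, G)" by (cases "r g")
    have "constructible (\<lambda>e. \<exists>c. (\<forall>(n, F) \<in> set (map r fs). poly (F e) c = 0) \<and> poly (G e) c \<noteq> 0)"
    proof (rule constructible_ex_system[of _ m])
      show "\<forall>(n, F) \<in> set (map r fs). ppoly n F" using r dnf_basic(1) by fastforce
      show "ppoly m G" using r[OF dnf_basic(2)] G by simp
    qed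
    moreover have "(\<forall>(n, F) \<in> set (map r fs). poly (F e) c = 0) \<longleftrightarrow> (\<forall>f \<in> set fs. f (case_nat c e) = 0)"
      for e c
    proof -
      have "(case r f of (n, F) \<Rightarrow> poly (F e) c = 0) \<longleftrightarrow> f (case_nat c e) = 0" if "f \<in> set fs" for f
        using r[of f] dnf_basic(1) that by (cases "r f") simp
      then show ?thesis by simp
    qed
    moreover have "g (case_nat c e) = poly (G e) c" for e c
      using r[OF dnf_basic(2)] G by simp
    ultimately show ?case by simp
  next
    case (dnf_or P Q)
    then show ?case using constructible_or by (simp add: ex_disj_distrib)
  qed
qed

text \<open>Bound variables are handled in de Bruijn style: the predicate under the quantifier reads its
  bound variable off index \<open>0\<close>.\<close>

lemma constructible_ex:
  assumes "constructible (\<lambda>e. P (e 0) (\<lambda>i. e (Suc i)))"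
  shows "constructible (\<lambda>e. \<exists>c. P c e)"
  using constructible_ex_case_nat[OF assms] by simp

lemma constructible_all:
  assumes "constructible (\<lambda>e. P (e 0) (\<lambda>i. e (Suc i)))"
  shows "constructible (\<lambda>e. \<forall>c. P c e)"
  using constructible_not[OF constructible_ex[of "\<lambda>c e. \<not> P c e"]] constructible_not[OF assms] by simp

section \<open>Formulas versus constructible predicates\<close>

lemma polyfun_tm_val: "polyfun (\<lambda>e. tm_val e t)"
  by (induction t) (auto intro: polyfun.intros polyfun_uminus)

lemma constructible_sat: "constructible (\<lambda>e. sat e p)"
proof (induction p)
  case (Exists i p)
  \<comment> \<open>The named variable \<open>i\<close> is read off coordinate \<open>0\<close> and
    every other variable is shifted by one, which is the shape that \<open>constructible_ex\<close>
    expects.\<close>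
  have "constructible (\<lambda>e. sat (\<lambda>j. (if j = i then (\<lambda>e. e 0) else (\<lambda>e. e (Suc j))) e) p)"
    by (rule constructible_subst[OF Exists]) (simp add: polyfun_var)
  moreover have "(\<lambda>j. (if j = i then (\<lambda>e. e 0) else (\<lambda>e. e (Suc j))) e) = (\<lambda>j. e (Suc j))(i := e 0)"
    for e :: "nat \<Rightarrow> complex" by auto
  ultimately have "constructible (\<lambda>e. sat ((\<lambda>j. e (Suc j))(i := e 0)) p)" by simp
  then show ?case using constructible_ex[of "\<lambda>c e. sat (e(i := c)) p"] by simp
qed (auto intro: constructible_eq polyfun_tm_val constructible_not constructible_and)

text \<open>Coordinates from \<open>k\<close> on are set to zero, so that the term respects the
  bound on free variables in the definition of \<open>definable\<close>.\<close>

lemma polyfun_imp_tm_val: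
  "polyfun f \<Longrightarrow> \<exists>t. tm_vars t \<subseteq> {..<k} \<and> (\<forall>e. tm_val e t = f (\<lambda>i. if i < k then e i else 0))"
proof (induction rule: polyfun.induct)
  case (polyfun_const c)
  show ?case by (intro exI[of _ "Param c"]) simp
next
  case (polyfun_var i)
  show ?case by (intro exI[of _ "if i < k then Var i else Zero"]) simp
next
  case (polyfun_add f g)
  then obtain s t where "tm_vars s \<subseteq> {..<k} \<and> (\<forall>e. tm_val e s = f (\<lambda>i. if i < k then e i else 0))"
    "tm_vars t \<subseteq> {..<k} \<and> (\<forall>e. tm_val e t = g (\<lambda>i. if i < k then e i else 0))" by blast
  then show ?case by (intro exI[of _ "Add s t"]) simp
next
  case (polyfun_mult f g)
  then obtain s t where "tm_vars s \<subseteq> {..<k} \<and> (\<forall>e. tm_val e s = f (\<lambda>i. if i < k then e i else 0))"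
    "tm_vars t \<subseteq> {..<k} \<and> (\<forall>e. tm_val e t = g (\<lambda>i. if i < k then e i else 0))" by blast
  then show ?case by (intro exI[of _ "Mul s t"]) simp
qed

lemma constructible_imp_sat:
  "constructible P \<Longrightarrow> \<exists>p. free_vars p \<subseteq> {..<k} \<and> (\<forall>e. sat e p = P (\<lambda>i. if i < k then e i else 0))"
proof (induction rule: constructible.induct)
  case (constructible_zero f)
  then obtain t where "tm_vars t \<subseteq> {..<k} \<and> (\<forall>e. tm_val e t = f (\<lambda>i. if i < k then e i else 0))"
    using polyfun_imp_tm_val by blast
  then show ?case by (intro exI[of _ "Eq t Zero"]) simp
next
  case (constructible_not P)
  then obtain p where "free_vars p \<subseteq> {..<k} \<and> (\<forall>e. sat e p = P (\<lambda>i. if i < k then e i else 0))" by blast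
  then show ?case by (intro exI[of _ "NOT p"]) simp
next
  case (constructible_and P Q)
  then obtain p q where "free_vars p \<subseteq> {..<k} \<and> (\<forall>e. sat e p = P (\<lambda>i. if i < k then e i else 0))"
    "free_vars q \<subseteq> {..<k} \<and> (\<forall>e. sat e q = Q (\<lambda>i. if i < k then e i else 0))" by blast
  then show ?case by (intro exI[of _ "And p q"]) simp
qed

section \<open>Saturation\<close>

lemma UN_lepoll_infinite:
  assumes "infinite B" "I \<lesssim> B" "\<And>i. i \<in> I \<Longrightarrow> A i \<lesssim> B"
  shows "(\<Union>i\<in>I. A i) \<lesssim> B"
  using card_of_UNION_ordLeq_infinite[of B I A] assms by (simp add: lepoll_def card_of_ordLeq)

text \<open>If the index set is infinite, a union of finite sets is no larger than it. Merely small
  members would not do: if the cardinality of \<open>\<complex>\<close> is singular, a small union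
  of small sets can be everything.\<close>

lemma UN_finite_small:
  assumes "I \<prec> (UNIV :: complex set)" "\<And>i. i \<in> I \<Longrightarrow> finite (A i)"
  shows "(\<Union>i\<in>I. A i) \<prec> (UNIV :: complex set)"
proof (cases "finite I")
  case True
  then show ?thesis
    using assms(2) by (intro finite_lesspoll_infinite) (auto simp: infinite_UNIV_char_0)
next
  case False
  then have "(\<Union>i\<in>I. A i) \<lesssim> I"
    using assms(2) by (intro UN_lepoll_infinite) (auto intro: finite_lepoll_infinite)
  then show ?thesis using assms(1) lesspoll_trans1 by blast
qed

lemma Un_small:
  assumes "A \<prec> (UNIV :: complex set)" "B \<prec> (UNIV :: complex set)"
  shows "A \<union> B \<prec> (UNIV :: complex set)"
proof -
  have *: "A \<union> B \<prec> (UNIV :: complex set)"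
    if "B \<prec> (UNIV :: complex set)" "A \<lesssim> B" for A B :: "'b set"
  proof (cases "finite B")
    case True
    then have "finite A" using that(2) finite_lepoll_infinite lepoll_antisym eqpoll_finite_iff by metis
    then show ?thesis using True by (intro finite_lesspoll_infinite) (auto simp: infinite_UNIV_char_0)
  next
    case False
    have "(\<Union>i\<in>{True, False}. if i then A else B) \<lesssim> B"
      using False that(2) by (intro UN_lepoll_infinite) (auto intro: finite_lepoll_infinite)
    then show ?thesis using that(1) lesspoll_trans1 by (auto simp: Un_commute)
  qed
  have "A \<lesssim> B \<or> B \<lesssim> A"
    using ordLeq_total[OF card_of_Well_order card_of_Well_order] by (auto simp: lepoll_def card_of_ordLeq)
  then show ?thesis using *[of B A] *[of A B] assms by (auto simp: Un_commute)
qed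

lemma image_small: "A \<prec> (UNIV :: complex set) \<Longrightarrow> f ` A \<prec> (UNIV :: complex set)"
  using image_lepoll lesspoll_trans1 by blast

lemma Fpow_small:
  assumes "I \<prec> (UNIV :: complex set)"
  shows "Fpow I \<prec> (UNIV :: complex set)"
proof (cases "finite I")
  case True
  then have "finite (Fpow I)" by (simp add: Fpow_Pow_finite)
  then show ?thesis by (intro finite_lesspoll_infinite) (auto simp: infinite_UNIV_char_0)
next
  case False
  then show ?thesis using assms eqpoll_Fpow eq_lesspoll_trans by blast
qed

text \<open>Saturation in one variable. If some member is finite, one of least cardinality lies
  inside all others by directedness; otherwise the finite complements are too few to cover
  \<open>\<complex>\<close>.\<close>

lemma directed_finite_cofinite_Inter:
  fixes A :: "'i \<Rightarrow> complex set"
  assumes I: "I \<prec> (UNIV :: complex set)"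
    and A: "\<And>i. i \<in> I \<Longrightarrow> finite (A i) \<or> finite (- A i)"
    and ne: "\<And>i. i \<in> I \<Longrightarrow> A i \<noteq> {}"
    and dir: "\<And>i j. i \<in> I \<Longrightarrow> j \<in> I \<Longrightarrow> \<exists>k\<in>I. A k \<subseteq> A i \<inter> A j"
  shows "\<exists>x. \<forall>i\<in>I. x \<in> A i"
proof (cases "\<exists>i\<in>I. finite (A i)")
  case True
  define i where "i = arg_min (\<lambda>i. card (A i)) (\<lambda>i. i \<in> I \<and> finite (A i))"
  obtain k where k: "k \<in> I \<and> finite (A k)" using True by blast
  have i: "i \<in> I" "finite (A i)"
    using arg_min_natI[of "\<lambda>i. i \<in> I \<and> finite (A i)" k "\<lambda>i. card (A i)"] k unfolding i_def by auto
  have min: "card (A i) \<le> card (A j)" if "j \<in> I" "finite (A j)" for j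
    using arg_min_nat_le[of "\<lambda>i. i \<in> I \<and> finite (A i)" j "\<lambda>i. card (A i)"] that unfolding i_def by auto
  have "A i \<subseteq> A j" if "j \<in> I" for j
  proof -
    have "\<exists>k\<in>I. A k \<subseteq> A i \<inter> A j" by (rule dir[OF i(1) \<open>j \<in> I\<close>])
    then obtain k where k: "k \<in> I" "A k \<subseteq> A i \<inter> A j" by blast
    then have "finite (A k)" using i finite_subset by blast
    then have "A k = A i" using card_seteq[of "A i" "A k"] i min k by auto
    then show ?thesis using k by blast
  qed
  then show ?thesis using ne[OF i(1)] by blast
next
  case False
  then have "(\<Union>i\<in>I. - A i) \<prec> (UNIV :: complex set)"
    using A by (intro UN_finite_small[OF I]) auto
  then have "(\<Union>i\<in>I. - A i) \<noteq> UNIV" using lesspoll_not_refl by metis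
  then show ?thesis by blast
qed

section \<open>Strong minimality, and saturation in several variables\<close>

lemma polyfun_poly:
  assumes "polyfun f"
  shows "\<exists>p. \<forall>c. f (\<lambda>i. poly (q i) c) = poly p c"
  using assms
proof induction
  case (polyfun_const c)
  show ?case by (intro exI[of _ "[:c:]"]) simp
next
  case (polyfun_add f g)
  then obtain p r where "\<And>c. f (\<lambda>i. poly (q i) c) = poly p c" "\<And>c. g (\<lambda>i. poly (q i) c) = poly r c"
    by blast
  then show ?case by (intro exI[of _ "p + r"]) simp
next
  case (polyfun_mult f g)
  then obtain p r where "\<And>c. f (\<lambda>i. poly (q i) c) = poly p c" "\<And>c. g (\<lambda>i. poly (q i) c) = poly r c"
    by blast
  then show ?case by (intro exI[of _ "p * r"]) simp
qed blast

text \<open>Along a polynomial curve the predicate is a Boolean combination of zero sets of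
  univariate polynomials.\<close>

lemma constructible_finite_cofinite:
  assumes "constructible P"
  shows "finite {c. P (\<lambda>i. poly (q i) c)} \<or> finite (- {c. P (\<lambda>i. poly (q i) c)})"
  using assms
proof induction
  case (constructible_zero f)
  obtain p where p: "\<And>c. f (\<lambda>i. poly (q i) c) = poly p c"
    using polyfun_poly[OF constructible_zero, of q] by blast
  show ?case using poly_roots_finite[of p] by (cases "p = 0") (auto simp: p)
next
  case (constructible_not P)
  then show ?case by (auto simp: Collect_neg_eq)
next
  case (constructible_and P Q)
  then show ?case by (auto simp: Collect_conj_eq)
qed

lemma constructible_fibre_finite_cofinite:
  assumes "constructible P"
  shows "finite {c. P (case_nat c e)} \<or> finite (- {c. P (case_nat c e)})"
proof -
  have "case_nat c e = (\<lambda>i. poly (case_nat [:0, 1:] (\<lambda>i. [:e i:]) i) c)" for c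
    by (auto split: nat.split)
  then show ?thesis
    using constructible_finite_cofinite[OF assms, of "case_nat [:0, 1:] (\<lambda>i. [:e i:])"] by simp
qed

definition depends_below :: "nat \<Rightarrow> ((nat \<Rightarrow> complex) \<Rightarrow> bool) \<Rightarrow> bool" where
  "depends_below k P \<longleftrightarrow> (\<forall>e e'. (\<forall>i<k. e i = e' i) \<longrightarrow> P e = P e')"

text \<open>Induction on the number of relevant coordinates: quantifier elimination projects
  coordinate \<open>0\<close> away, the other coordinates are found by induction, and the
  one-variable case supplies a point of the fibre over them.\<close>

lemma saturation:
  assumes "I \<prec> (UNIV :: complex set)" "I \<noteq> {}"
    and "\<And>i. i \<in> I \<Longrightarrow> constructible (U i)"
    and "\<And>i. i \<in> I \<Longrightarrow> depends_below k (U i)"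
    and "\<And>i j. i \<in> I \<Longrightarrow> j \<in> I \<Longrightarrow> \<exists>l\<in>I. \<forall>e. U l e \<longrightarrow> U i e \<and> U j e"
    and "\<And>i. i \<in> I \<Longrightarrow> \<exists>e. U i e"
  shows "\<exists>e. \<forall>i\<in>I. U i e"
  using assms(3-)
proof (induction k arbitrary: U)
  case 0
  then have "U i e = U i e'" if "i \<in> I" for i e e'
    using that unfolding depends_below_def by blast
  then show ?case using 0(4) by blast
next
  case (Suc k)
  define V where "V i e = (\<exists>c. U i (case_nat c e))" for i e
  have "\<exists>e. \<forall>i\<in>I. V i e"
  proof (rule Suc.IH)
    fix i assume i: "i \<in> I"
    show "constructible (V i)"
      unfolding V_def using Suc.prems(1)[OF i] by (rule constructible_ex_case_nat)
    have "U i (case_nat c e) = U i (case_nat c e')" if "\<forall>j<k. e j = e' j" for e e' c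
      using Suc.prems(2)[OF i] that unfolding depends_below_def by (auto split: nat.split)
    then show "depends_below k (V i)" unfolding depends_below_def V_def by blast
    obtain e where "U i e" using Suc.prems(4) i by blast
    moreover have "e = case_nat (e 0) (\<lambda>i. e (Suc i))" by (auto split: nat.split)
    ultimately show "\<exists>e. V i e" unfolding V_def by metis
    fix j assume "j \<in> I"
    then show "\<exists>l\<in>I. \<forall>e. V l e \<longrightarrow> V i e \<and> V j e"
      using Suc.prems(3) i unfolding V_def by meson
  qed
  then obtain e where e: "\<And>i. i \<in> I \<Longrightarrow> V i e" by blast
  have "\<exists>c. \<forall>i\<in>I. c \<in> {c. U i (case_nat c e)}"
  proof (rule directed_finite_cofinite_Inter[OF assms(1)])
    show "finite {c. U i (case_nat c e)} \<or> finite (- {c. U i (case_nat c e)})" if "i \<in> I" for i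
      using constructible_fibre_finite_cofinite[OF Suc.prems(1)[OF that]] .
    show "{c. U i (case_nat c e)} \<noteq> {}" if "i \<in> I" for i
      using e[OF that] unfolding V_def by blast
    show "\<exists>l\<in>I. {c. U l (case_nat c e)} \<subseteq> {c. U i (case_nat c e)} \<inter> {c. U j (case_nat c e)}"
      if "i \<in> I" "j \<in> I" for i j
      using Suc.prems(3)[OF that] by blast
  qed
  then show ?case by blast
qed

section \<open>Small intersections of constructible predicates\<close>

definition inf_constr :: "((nat \<Rightarrow> complex) \<Rightarrow> bool) \<Rightarrow> bool" where
  "inf_constr P \<longleftrightarrow> (\<exists>\<U>. \<U> \<prec> (UNIV :: complex set) \<and> \<U> \<noteq> {} \<and> (\<forall>U\<in>\<U>. constructible U) \<and>
     (\<forall>U\<in>\<U>. \<forall>V\<in>\<U>. \<exists>W\<in>\<U>. \<forall>e. W e \<longrightarrow> U e \<and> V e) \<and> (\<forall>e. P e \<longleftrightarrow> (\<forall>U\<in>\<U>. U e)))"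

lemma inf_constrE:
  assumes "inf_constr P"
  obtains \<U> where "\<U> \<prec> (UNIV :: complex set)" "\<U> \<noteq> {}" "\<And>U. U \<in> \<U> \<Longrightarrow> constructible U"
    "\<And>U V. U \<in> \<U> \<Longrightarrow> V \<in> \<U> \<Longrightarrow> \<exists>W\<in>\<U>. \<forall>e. W e \<longrightarrow> U e \<and> V e"
    "\<And>e. P e \<longleftrightarrow> (\<forall>U\<in>\<U>. U e)"
proof -
  from assms obtain \<U> where "\<U> \<prec> (UNIV :: complex set) \<and> \<U> \<noteq> {} \<and> (\<forall>U\<in>\<U>. constructible U) \<and>
     (\<forall>U\<in>\<U>. \<forall>V\<in>\<U>. \<exists>W\<in>\<U>. \<forall>e. W e \<longrightarrow> U e \<and> V e) \<and> (\<forall>e. P e \<longleftrightarrow> (\<forall>U\<in>\<U>. U e))"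
    unfolding inf_constr_def by (rule exE)
  then show ?thesis by (intro that[of \<U>]) simp_all
qed

text \<open>Passing to finite conjunctions makes the family directed without making it large.
  Directedness is what later allows an existential quantifier to pass through the
  intersection.\<close>

lemma inf_constrI:
  assumes small: "\<U> \<prec> (UNIV :: complex set)" and constr: "\<And>U. U \<in> \<U> \<Longrightarrow> constructible U"
    and P: "\<And>e. P e \<longleftrightarrow> (\<forall>U\<in>\<U>. U e)"
  shows "inf_constr P"
  unfolding inf_constr_def
proof (intro exI conjI ballI allI)
  define \<V> where "\<V> = (\<lambda>F e. \<forall>U\<in>F. U e) ` Fpow \<U>"
  show "\<V> \<prec> (UNIV :: complex set)"
    unfolding \<V>_def by (intro image_small Fpow_small small)
  show "\<V> \<noteq> {}" by (simp add: \<V>_def Fpow_not_empty)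
  show "constructible U" if "U \<in> \<V>" for U
    using that constr by (auto simp: \<V>_def Fpow_def intro!: constructible_Ball_finite[where P = "\<lambda>U. U"])
  show "\<exists>W\<in>\<V>. \<forall>e. W e \<longrightarrow> U e \<and> V e" if UV: "U \<in> \<V>" "V \<in> \<V>" for U V
  proof -
    obtain F G where FG: "F \<in> Fpow \<U>" "G \<in> Fpow \<U>" and "U = (\<lambda>e. \<forall>U\<in>F. U e)" "V = (\<lambda>e. \<forall>U\<in>G. U e)"
      using UV by (auto simp: \<V>_def)
    moreover have "F \<union> G \<in> Fpow \<U>" using FG by (auto simp: Fpow_def)
    ultimately show ?thesis unfolding \<V>_def by (intro bexI[OF _ imageI[of "F \<union> G"]]) auto
  qed
  show "P e \<longleftrightarrow> (\<forall>U\<in>\<V>. U e)" for e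
  proof
    assume *: "\<forall>U\<in>\<V>. U e"
    have "U e" if "U \<in> \<U>" for U
    proof -
      have "(\<lambda>e. \<forall>U'\<in>{U}. U' e) \<in> \<V>" using that unfolding \<V>_def by (intro imageI) (auto simp: Fpow_def)
      then show ?thesis using * by fastforce
    qed
    then show "P e" using P by blast
  qed (auto simp: P \<V>_def Fpow_def)
qed

lemma constructible_imp_inf_constr: "constructible P \<Longrightarrow> inf_constr P"
  by (rule inf_constrI[of "{P}"]) (auto intro: finite_lesspoll_infinite simp: infinite_UNIV_char_0)

lemma inf_constr_and:
  assumes "inf_constr P" "inf_constr Q"
  shows "inf_constr (\<lambda>e. P e \<and> Q e)"
proof -
  obtain \<U> where U: "\<U> \<prec> (UNIV :: complex set)" "\<And>U. U \<in> \<U> \<Longrightarrow> constructible U"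
      "\<And>e. P e \<longleftrightarrow> (\<forall>U\<in>\<U>. U e)"
    using assms(1) by (rule inf_constrE) blast
  obtain \<V> where V: "\<V> \<prec> (UNIV :: complex set)" "\<And>U. U \<in> \<V> \<Longrightarrow> constructible U"
      "\<And>e. Q e \<longleftrightarrow> (\<forall>U\<in>\<V>. U e)"
    using assms(2) by (rule inf_constrE) blast
  show ?thesis
  proof (rule inf_constrI)
    show "\<U> \<union> \<V> \<prec> (UNIV :: complex set)" by (rule Un_small[OF U(1) V(1)])
    show "P e \<and> Q e \<longleftrightarrow> (\<forall>U\<in>\<U> \<union> \<V>. U e)" for e using U(3) V(3) by blast
  qed (use U(2) V(2) in blast)
qed

lemma inf_constr_subst:
  assumes "inf_constr P" and "\<And>i. polyfun (g i)"
  shows "inf_constr (\<lambda>e. P (\<lambda>i. g i e))"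
proof -
  obtain \<U> where U: "\<U> \<prec> (UNIV :: complex set)" "\<And>U. U \<in> \<U> \<Longrightarrow> constructible U"
      "\<And>e. P e \<longleftrightarrow> (\<forall>U\<in>\<U>. U e)"
    using assms(1) by (rule inf_constrE) blast
  show ?thesis
  proof (rule inf_constrI)
    show "(\<lambda>U e. U (\<lambda>i. g i e)) ` \<U> \<prec> (UNIV :: complex set)" by (rule image_small[OF U(1)])
    show "constructible V" if "V \<in> (\<lambda>U e. U (\<lambda>i. g i e)) ` \<U>" for V
      using that constructible_subst[OF U(2) assms(2)] by auto
    show "P (\<lambda>i. g i e) \<longleftrightarrow> (\<forall>V\<in>(\<lambda>U e. U (\<lambda>i. g i e)) ` \<U>. V e)" for e
      using U(3) by simp
  qed
qed

text \<open>The only nontrivial inclusion, from a witness for each member to a common witness, is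
  one-variable saturation in the fibre over \<open>e\<close>.\<close>

lemma inf_constr_ex:
  assumes "inf_constr (\<lambda>e. P (e 0) (\<lambda>i. e (Suc i)))"
  shows "inf_constr (\<lambda>e. \<exists>c. P c e)"
proof -
  obtain \<U> where U: "\<U> \<prec> (UNIV :: complex set)" "\<U> \<noteq> {}" "\<And>U. U \<in> \<U> \<Longrightarrow> constructible U"
      "\<And>U V. U \<in> \<U> \<Longrightarrow> V \<in> \<U> \<Longrightarrow> \<exists>W\<in>\<U>. \<forall>e. W e \<longrightarrow> U e \<and> V e"
      "\<And>e. P (e 0) (\<lambda>i. e (Suc i)) \<longleftrightarrow> (\<forall>U\<in>\<U>. U e)"
    using assms by (rule inf_constrE) blast
  have P: "P c e \<longleftrightarrow> (\<forall>U\<in>\<U>. U (case_nat c e))" for c e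
    using U(5)[of "case_nat c e"] by simp
  show ?thesis
  proof (rule inf_constrI)
    show "(\<lambda>U e. \<exists>c. U (case_nat c e)) ` \<U> \<prec> (UNIV :: complex set)" by (rule image_small[OF U(1)])
    show "constructible V" if "V \<in> (\<lambda>U e. \<exists>c. U (case_nat c e)) ` \<U>" for V
      using that U(3) constructible_ex_case_nat by auto
    show "(\<exists>c. P c e) \<longleftrightarrow> (\<forall>V\<in>(\<lambda>U e. \<exists>c. U (case_nat c e)) ` \<U>. V e)" for e
    proof
      assume *: "\<forall>V\<in>(\<lambda>U e. \<exists>c. U (case_nat c e)) ` \<U>. V e"
      then have sat: "\<exists>c. U (case_nat c e)" if "U \<in> \<U>" for U
        using * that by simp
      have "\<exists>c. \<forall>U\<in>\<U>. c \<in> {c. U (case_nat c e)}"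
      proof (rule directed_finite_cofinite_Inter[OF U(1)])
        show "finite {c. U (case_nat c e)} \<or> finite (- {c. U (case_nat c e)})" if "U \<in> \<U>" for U
          by (rule constructible_fibre_finite_cofinite[OF U(3)[OF that]])
        show "{c. U (case_nat c e)} \<noteq> {}" if "U \<in> \<U>" for U using sat[OF that] by simp
        show "\<exists>W\<in>\<U>. {c. W (case_nat c e)} \<subseteq> {c. U (case_nat c e)} \<inter> {c. V (case_nat c e)}"
          if "U \<in> \<U>" "V \<in> \<U>" for U V
          using U(4)[OF that] by blast
      qed
      then show "\<exists>c. P c e" by (simp add: P)
    qed (auto simp: P)
  qed
qed

text \<open>Relations between complex numbers are tested on the first few coordinates of an
  environment.\<close>

lemma constructible_subst1:
  assumes "constructible (\<lambda>e. Q (e 0))" "polyfun f"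
  shows "constructible (\<lambda>e. Q (f e))"
  using constructible_subst[OF assms(1), of "\<lambda>_. f"] assms(2) by simp

lemma constructible_subst2:
  assumes "constructible (\<lambda>e. Q (e 0) (e 1))" "polyfun f" "polyfun g"
  shows "constructible (\<lambda>e. Q (f e) (g e))"
  using constructible_subst[OF assms(1), of "\<lambda>i. if i = 0 then f else g"] assms(2,3) by simp

lemma constructible_subst3:
  assumes "constructible (\<lambda>e. Q (e 0) (e 1) (e 2))" "polyfun f" "polyfun g" "polyfun h"
  shows "constructible (\<lambda>e. Q (f e) (g e) (h e))"
  using constructible_subst[OF assms(1), of "\<lambda>i. if i = 0 then f else if i = 1 then g else h"] assms(2-)
  by simp

lemma inf_constr_subst3:
  assumes "inf_constr (\<lambda>e. Q (e 0) (e 1) (e 2))" "polyfun f" "polyfun g" "polyfun h"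
  shows "inf_constr (\<lambda>e. Q (f e) (g e) (h e))"
  using inf_constr_subst[OF assms(1), of "\<lambda>i. if i = 0 then f else if i = 1 then g else h"] assms(2-)
  by simp

text \<open>By saturation a single member \<open>U\<close> of the family already forces any two
  points of a fibre over \<open>B\<close> to be related by \<open>R\<close>. Every fibre contains a
  point of \<open>Z\<close>, and \<open>Z\<close> is closed under \<open>R\<close>, so
  \<open>Z\<close> is cut out by \<open>B\<close> and \<open>U\<close>.\<close>

lemma constructible_of_inf_constr_fibres:
  fixes Z :: "complex \<Rightarrow> complex \<Rightarrow> complex \<Rightarrow> bool"
  assumes Z: "inf_constr (\<lambda>e. Z (e 0) (e 1) (e 2))"
    and B: "constructible (\<lambda>e. B (e 0) (e 1))" and R: "constructible (\<lambda>e. R (e 0) (e 1))"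
    and ZB: "\<And>x y z. Z x y z \<Longrightarrow> B x z" and BZ: "\<And>x z. B x z \<Longrightarrow> \<exists>y. Z x y z"
    and ZR: "\<And>x y y' z. Z x y z \<Longrightarrow> Z x y' z \<Longrightarrow> R y y'"
    and RZ: "\<And>x y y' z. R y y' \<Longrightarrow> Z x y' z \<Longrightarrow> Z x y z"
  shows "constructible (\<lambda>e. Z (e 0) (e 1) (e 2))"
proof -
  obtain \<U> where U: "\<U> \<prec> (UNIV :: complex set)" "\<U> \<noteq> {}" "\<And>U. U \<in> \<U> \<Longrightarrow> constructible U"
      "\<And>U V. U \<in> \<U> \<Longrightarrow> V \<in> \<U> \<Longrightarrow> \<exists>W\<in>\<U>. \<forall>e. W e \<longrightarrow> U e \<and> V e"
      "\<And>e. Z (e 0) (e 1) (e 2) \<longleftrightarrow> (\<forall>U\<in>\<U>. U e)"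
    using Z by (rule inf_constrE) blast
  \<comment> \<open>Filling up with zeros makes the dependence on finitely many coordinates
    explicit, although a member of the family may look at further ones.\<close>
  define env where "env x y z i = (if i = 0 then x else if i = 1 then y else if i = 2 then z else 0)"
    for x y z :: complex and i :: nat
  have Z_iff: "Z x y z \<longleftrightarrow> (\<forall>U\<in>\<U>. U (env x y z))" for x y z
    using U(5)[of "env x y z"] by (simp add: env_def)
  \<comment> \<open>A counterexample to \<open>R\<close> inside \<open>U\<close>: coordinates
    \<open>0\<close> and \<open>3\<close> are the base point, coordinates \<open>1\<close> and
    \<open>2\<close> two unrelated points of its fibre.\<close>
  define W where "W U e \<longleftrightarrow> U (env (e 0) (e 1) (e 3)) \<and> U (env (e 0) (e 2) (e 3)) \<and>
      B (e 0) (e 3) \<and> \<not> R (e 1) (e 2)" for U and e :: "nat \<Rightarrow> complex"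
  have env: "constructible (\<lambda>e. U (env (e i) (e j) (e k)))" if "U \<in> \<U>" for U i j k
  proof -
    have "polyfun (\<lambda>e. env (e i) (e j) (e k) l)" for l
      unfolding env_def by (cases "l = 0"; cases "l = 1"; cases "l = 2") (simp_all add: polyfun_var polyfun_const)
    then show ?thesis using constructible_subst[OF U(3)[OF that]] by simp
  qed
  have "\<exists>U\<in>\<U>. \<forall>e. \<not> W U e"
  proof (rule ccontr)
    assume "\<not> ?thesis"
    then have sat: "\<exists>e. W U e" if "U \<in> \<U>" for U using that by blast
    have "\<exists>e. \<forall>U\<in>\<U>. W U e"
    proof (rule saturation[OF U(1,2), of _ 4])
      fix U assume "U \<in> \<U>"
      then show "constructible (W U)"
        unfolding W_def
        by (intro constructible_and constructible_not env constructible_subst2[OF B]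
            constructible_subst2[OF R] polyfun_var)
      show "depends_below 4 (W U)" unfolding W_def depends_below_def by simp
      show "\<exists>e. W U e" by (rule sat[OF \<open>U \<in> \<U>\<close>])
      fix V assume "V \<in> \<U>"
      obtain X where X: "X \<in> \<U>" "\<forall>e. X e \<longrightarrow> U e \<and> V e" using U(4)[OF \<open>U \<in> \<U>\<close> \<open>V \<in> \<U>\<close>] by blast
      then have "\<forall>e. W X e \<longrightarrow> W U e \<and> W V e" unfolding W_def by simp
      then show "\<exists>X\<in>\<U>. \<forall>e. W X e \<longrightarrow> W U e \<and> W V e" using X(1) by blast
    qed
    then obtain e where "\<And>U. U \<in> \<U> \<Longrightarrow> W U e" by blast
    then have "Z (e 0) (e 1) (e 3)" "Z (e 0) (e 2) (e 3)" "\<not> R (e 1) (e 2)"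
      using U(2) by (auto simp: Z_iff W_def)
    then show False using ZR by blast
  qed
  then obtain U where UU: "U \<in> \<U>" and no: "\<And>e. \<not> W U e" by blast
  have R: "R y y'" if "U (env x y z)" "U (env x y' z)" "B x z" for x y y' z
    using no[of "\<lambda>i. if i = 0 then x else if i = 1 then y else if i = 2 then y' else z"] that
    by (simp add: W_def)
  have "Z x y z \<longleftrightarrow> B x z \<and> U (env x y z)" for x y z
  proof
    assume *: "B x z \<and> U (env x y z)"
    then obtain y' where y': "Z x y' z" using BZ by blast
    then have "R y y'" using R * UU Z_iff by blast
    then show "Z x y z" using RZ y' by blast
  qed (use ZB Z_iff UU in blast)
  moreover have "constructible (\<lambda>e. B (e 0) (e 2) \<and> U (env (e 0) (e 1) (e 2)))"
    by (intro constructible_and constructible_subst2[OF B] polyfun_var env UU)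
  ultimately show ?thesis by simp
qed

section \<open>One-dimensional sets and the monoids among them\<close>

definition tame :: "complex set \<Rightarrow> bool" where
  "tame A \<longleftrightarrow> finite A \<or> - A \<prec> (UNIV :: complex set)"

text \<open>If the set is infinite, every constructible superset in the family is infinite, hence
  cofinite, and the complement is a small union of finite sets.\<close>

lemma inf_constr_tame:
  assumes "inf_constr (\<lambda>e. A (e 0))"
  shows "tame {x. A x}"
proof -
  obtain \<U> where U: "\<U> \<prec> (UNIV :: complex set)" "\<And>U. U \<in> \<U> \<Longrightarrow> constructible U"
      "\<And>e. A (e 0) \<longleftrightarrow> (\<forall>U\<in>\<U>. U e)"
    using assms by (rule inf_constrE) blast
  define F where "F U = {c. U (case_nat c (\<lambda>_. 0))}" for U :: "(nat \<Rightarrow> complex) \<Rightarrow> bool"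
  have A: "{x. A x} = (\<Inter>U\<in>\<U>. F U)"
    using U(3)[of "case_nat _ (\<lambda>_. 0)"] by (auto simp: F_def)
  show ?thesis
  proof (cases "finite {x. A x}")
    case False
    then have "finite (- F U)" if "U \<in> \<U>" for U
      using constructible_fibre_finite_cofinite[OF U(2)[OF that], of "\<lambda>_. 0"] A that
        finite_subset[of "{x. A x}" "F U"] by (auto simp: F_def)
    then have "(\<Union>U\<in>\<U>. - F U) \<prec> (UNIV :: complex set)" by (rule UN_finite_small[OF U(1)])
    then show ?thesis by (simp add: tame_def A)
  qed (simp add: tame_def)
qed

text \<open>On a finite set, multiplication by a member is a permutation. If the complement is
  small, some \<open>x\<close> has both \<open>x\<close> and \<open>c / x\<close> in the set, so
  every nonzero \<open>c\<close> is a product.\<close>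

lemma tame_mult_closed:
  assumes "tame A" "A \<noteq> {}" "0 \<notin> A" and mult: "\<And>x y. x \<in> A \<Longrightarrow> y \<in> A \<Longrightarrow> x * y \<in> A"
  shows "finite A \<or> A = - {0}" and "1 \<in> A" and "\<And>x. x \<in> A \<Longrightarrow> inverse x \<in> A"
proof -
  have "(finite A \<or> A = - {0}) \<and> 1 \<in> A \<and> (\<forall>x\<in>A. inverse x \<in> A)"
  proof (cases "finite A")
    case True
    have *: "(*) x ` A = A" if "x \<in> A" for x
    proof (rule card_subset_eq[OF True])
      show "(*) x ` A \<subseteq> A" using mult that by auto
      have "x \<noteq> 0" using that assms(3) by auto
      then show "card ((*) x ` A) = card A" by (intro card_image) (auto simp: inj_on_def)
    qed
    have one: "1 \<in> A"
    proof -
      obtain x where x: "x \<in> A" using assms(2) by blast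
      then obtain y where "y \<in> A" "x = x * y" using *[OF x] by blast
      moreover have "x \<noteq> 0" using x assms(3) by auto
      ultimately show ?thesis by simp
    qed
    have "inverse x \<in> A" if x: "x \<in> A" for x
    proof -
      obtain y where "y \<in> A" "1 = x * y" using *[OF x] one by blast
      then show ?thesis using inverse_unique[of x y] by simp
    qed
    then show ?thesis using True one by blast
  next
    case False
    then have small: "- A \<prec> (UNIV :: complex set)" using assms(1) by (simp add: tame_def)
    have "c \<in> A" if "c \<noteq> 0" for c
    proof -
      have "- A \<union> (\<lambda>y. c / y) ` (- A) \<prec> (UNIV :: complex set)"
        by (intro Un_small image_small small)
      then have "- A \<union> (\<lambda>y. c / y) ` (- A) \<noteq> UNIV" using lesspoll_not_refl by metis
      then obtain x where x: "x \<in> A" "x \<notin> (\<lambda>y. c / y) ` (- A)" by blast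
      moreover have "x \<noteq> 0" using x assms(3) by auto
      moreover have "c / (c / x) = x" using that by simp
      ultimately have "c / x \<in> A" by (metis ComplI image_eqI)
      then have "x * (c / x) \<in> A" using mult x by blast
      then show ?thesis using \<open>x \<noteq> 0\<close> by simp
    qed
    then have "A = - {0}" using assms(3) by auto
    then show ?thesis by simp
  qed
  then show "finite A \<or> A = - {0}" "1 \<in> A" "\<And>x. x \<in> A \<Longrightarrow> inverse x \<in> A" by auto
qed

text \<open>In characteristic zero a nonzero member has infinitely many multiples. If the complement
  is small, every number is a sum of two members.\<close>

lemma tame_add_closed:
  assumes "tame A" "0 \<in> A" and add: "\<And>x y. x \<in> A \<Longrightarrow> y \<in> A \<Longrightarrow> x + y \<in> A"
  shows "A = {0} \<or> A = UNIV"
proof (cases "finite A")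
  case True
  have "x = 0" if "x \<in> A" for x
  proof (rule ccontr)
    assume "x \<noteq> 0"
    have "of_nat n * x \<in> A" for n
      by (induction n) (auto simp: assms(2) ring_distribs intro: add that)
    then have "range (\<lambda>n. of_nat n * x) \<subseteq> A" by blast
    moreover have "inj (\<lambda>n. of_nat n * x)" using \<open>x \<noteq> 0\<close> by (simp add: inj_def)
    ultimately show False using True finite_subset range_inj_infinite by blast
  qed
  then show ?thesis using assms(2) by auto
next
  case False
  then have small: "- A \<prec> (UNIV :: complex set)" using assms(1) by (simp add: tame_def)
  have "c \<in> A" for c
  proof -
    have "- A \<union> (\<lambda>y. c - y) ` (- A) \<prec> (UNIV :: complex set)"
      by (intro Un_small image_small small)
    then have "- A \<union> (\<lambda>y. c - y) ` (- A) \<noteq> UNIV" using lesspoll_not_refl by metis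
    then obtain x where x: "x \<in> A" "x \<notin> (\<lambda>y. c - y) ` (- A)" by blast
    moreover have "c - (c - x) = x" by simp
    ultimately have "c - x \<in> A" by (metis ComplI image_eqI)
    then have "x + (c - x) \<in> A" using add x by blast
    then show ?thesis by simp
  qed
  then show ?thesis by auto
qed

lemma constructible_mem_finite:
  assumes "finite A" "polyfun f"
  shows "constructible (\<lambda>e. f e \<in> A)"
proof -
  have "constructible (\<lambda>e. \<exists>a\<in>A. f e = a)"
    by (intro constructible_Bex_finite constructible_eq assms polyfun_const)
  then show ?thesis by simp
qed

lemma constructible_mem:
  assumes "finite A \<or> A = - {0}" "polyfun f"
  shows "constructible (\<lambda>e. f e \<in> A)"
  using assms constructible_mem_finite constructible_not[OF constructible_zero] by auto

section \<open>Triangular monoids\<close>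

text \<open>The relation \<open>m a b d\<close> stands for membership of the upper triangular matrix with diagonal
  entries \<open>a\<close>, \<open>d\<close> and off-diagonal entry \<open>b\<close>.\<close>

definition units_of_tri :: "(complex \<Rightarrow> complex \<Rightarrow> complex \<Rightarrow> bool) \<Rightarrow> complex \<Rightarrow> complex \<Rightarrow> complex \<Rightarrow> bool" where
  "units_of_tri m a b d \<longleftrightarrow> m a b d \<and> a \<noteq> 0 \<and> d \<noteq> 0"

text \<open>A matrix with \<open>d = 0\<close> and \<open>a\<close> nonzero has rank one and its
  image is the first coordinate axis, which represents the line \<open>v\<close>. Below such
  matrices are called rows.\<close>

definition row_scalars :: "(complex \<Rightarrow> complex \<Rightarrow> complex \<Rightarrow> bool) \<Rightarrow> complex set" where
  "row_scalars m = {a. a \<noteq> 0 \<and> (\<exists>b. m a b 0)}"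

text \<open>On the left, rows act on rows by scaling with their upper-left entry; so do units, whose
  upper-left entries are row scalars as soon as there are any rows. On the right, units act by the
  last formula.\<close>

definition row_stable ::
  "(complex \<Rightarrow> complex \<Rightarrow> complex \<Rightarrow> bool) \<Rightarrow> (complex \<Rightarrow> complex \<Rightarrow> bool) \<Rightarrow> bool" where
  "row_stable m X \<longleftrightarrow> (\<forall>a b. X a b \<longrightarrow> a \<in> row_scalars m \<and> (\<forall>t\<in>row_scalars m. X (t * a) (t * b)) \<and>
     (\<forall>x y z. units_of_tri m x y z \<longrightarrow> X (a * x) (a * y + b * z)))"

locale tri_monoid =
  fixes m :: "complex \<Rightarrow> complex \<Rightarrow> complex \<Rightarrow> bool"
  assumes one: "m 1 0 1"
    and mult: "m a b d \<Longrightarrow> m a' b' d' \<Longrightarrow> m (a * a') (a * b' + b * d') (d * d')"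
    and inf_constr: "inf_constr (\<lambda>e. m (e 0) (e 1) (e 2))"

text \<open>Reflection in the antidiagonal is an anti-automorphism of the triangular matrices; it
  exchanges matrices with image \<open>v\<close> and matrices with kernel \<open>v\<close>.\<close>

lemma (in tri_monoid) tri_monoid_mirror: "tri_monoid (\<lambda>a b d. m d b a)"
proof
  show "m 1 0 1" by (rule one)
  show "m (d * d') (a * b' + b * d') (a * a')" if "m d b a" "m d' b' a'" for a b d a' b' d'
    using mult[OF that(2,1)] by (simp add: mult.commute add.commute)
  show "inf_constr (\<lambda>e. m (e 2) (e 1) (e 0))"
    by (intro inf_constr_subst3[OF inf_constr] polyfun_var)
qed

context tri_monoid
begin

abbreviation "H \<equiv> units_of_tri m"
abbreviation "A \<equiv> row_scalars m"

lemma inf_constr_m: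
  "polyfun f \<Longrightarrow> polyfun g \<Longrightarrow> polyfun h \<Longrightarrow> inf_constr (\<lambda>e. m (f e) (g e) (h e))"
  by (rule inf_constr_subst3[OF inf_constr])

lemma inf_constr_H:
  "polyfun f \<Longrightarrow> polyfun g \<Longrightarrow> polyfun h \<Longrightarrow> inf_constr (\<lambda>e. H (f e) (g e) (h e))"
  unfolding units_of_tri_def
  by (intro inf_constr_and inf_constr_m constructible_imp_inf_constr constructible_not constructible_zero)

lemma H_mult: "H a b d \<Longrightarrow> H a' b' d' \<Longrightarrow> H (a * a') (a * b' + b * d') (d * d')"
  unfolding units_of_tri_def using mult by simp

lemma H_one: "H 1 0 1"
  unfolding units_of_tri_def using one by simp

text \<open>The units are analysed by successive projections: the entry \<open>d\<close>, then
  \<open>a\<close> over fixed \<open>d\<close>, then \<open>b\<close>. At each stage the fibres are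
  translates of a one-dimensional monoid that is finite or as large as possible; full fibres are
  definable outright and finite ones by saturation.\<close>

lemma constructible_H: "constructible (\<lambda>e. H (e 0) (e 1) (e 2))"
proof -
  \<comment> \<open>\<open>E\<close> is the image of the units in the diagonal pairs,
    \<open>Q\<close> its projection to \<open>d\<close>, \<open>K\<close> the kernel of that
    projection, and \<open>L\<close> the unipotent part.\<close>
  define E where "E a d \<longleftrightarrow> (\<exists>b. H a b d)" for a d
  define Q where "Q = {d. \<exists>a. E a d}"
  define K where "K = {a. E a 1}"
  define L where "L = {b. H 1 b 1}"
  have E_mult: "E (a * a') (d * d')" if "E a d" "E a' d'" for a d a' d'
    using that H_mult unfolding E_def by blast
  have E_one: "E 1 1" using H_one unfolding E_def by blast
  have E_nz: "a \<noteq> 0 \<and> d \<noteq> 0" if "E a d" for a d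
    using that unfolding E_def units_of_tri_def by blast
  have inf_E: "inf_constr (\<lambda>e. E (f e) (g e))" if "polyfun f" "polyfun g" for f g
  proof -
    have "inf_constr (\<lambda>e. \<exists>b. H (e 0) b (e 1))"
      by (intro inf_constr_ex inf_constr_H polyfun_var)
    then have "inf_constr (\<lambda>e. E (e 0) (e 1))" unfolding E_def .
    from inf_constr_subst3[where Q = "\<lambda>x y z. E x y", OF this that that(2)] show ?thesis .
  qed
  have "inf_constr (\<lambda>e. \<exists>a. E a (e 0))" by (intro inf_constr_ex inf_E polyfun_var)
  then have "tame Q" unfolding Q_def by (rule inf_constr_tame)
  moreover have "Q \<noteq> {}" using E_one unfolding Q_def by blast
  moreover have "0 \<notin> Q" using E_nz unfolding Q_def by blast
  moreover have "x * y \<in> Q" if "x \<in> Q" "y \<in> Q" for x y using that E_mult unfolding Q_def by blast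
  ultimately have Q: "finite Q \<or> Q = - {0}" "\<And>x. x \<in> Q \<Longrightarrow> inverse x \<in> Q"
    using tame_mult_closed[of Q] by blast+
  have "inf_constr (\<lambda>e. E (e 0) 1)" by (intro inf_E polyfun_var polyfun_const)
  then have "tame K" unfolding K_def by (rule inf_constr_tame)
  moreover have "K \<noteq> {}" using E_one unfolding K_def by blast
  moreover have "0 \<notin> K" using E_nz unfolding K_def by blast
  moreover have "x * y \<in> K" if "x \<in> K" "y \<in> K" for x y using that E_mult[of x 1 y 1] unfolding K_def by simp
  ultimately have K: "finite K \<or> K = - {0}" "\<And>x. x \<in> K \<Longrightarrow> inverse x \<in> K"
    using tame_mult_closed[of K] by blast+
  have E_ratio: "a / a' \<in> K" if "E a d" "E a' d" for a a' d
  proof -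
    \<comment> \<open>Inverses are available so far only in \<open>Q\<close> and \<open>K\<close>;
      an element over \<open>inverse d\<close> carries both points into \<open>K\<close>, where
      their quotient can be formed.\<close>
    have "inverse d \<in> Q" using that(1) Q(2) unfolding Q_def by blast
    then obtain a'' where a'': "E a'' (inverse d)" unfolding Q_def by blast
    have "a * a'' \<in> K" "a' * a'' \<in> K"
      using E_mult[OF that(1) a''] E_mult[OF that(2) a''] E_nz[OF that(1)] by (auto simp: K_def)
    then have "(a * a'') * inverse (a' * a'') \<in> K"
      using K(2) \<open>\<And>x y. x \<in> K \<Longrightarrow> y \<in> K \<Longrightarrow> x * y \<in> K\<close> by blast
    then show ?thesis using E_nz[OF a''] by (simp add: field_simps)
  qed
  have E_scale: "E (k * a) d" if "k \<in> K" "E a d" for k a d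
    using E_mult[of k 1 a d] that by (simp add: K_def)
  have E_inverse: "E (inverse a) (inverse d)" if "E a d" for a d
  proof -
    have "inverse d \<in> Q" using that Q(2) unfolding Q_def by blast
    then obtain a' where a': "E a' (inverse d)" unfolding Q_def by blast
    have "a * a' \<in> K" using E_mult[OF that a'] E_nz[OF that] by (simp add: K_def)
    then have "inverse (a * a') * a' = inverse a" "inverse (a * a') \<in> K"
      using K(2) E_nz[OF a'] by (auto simp: field_simps)
    then show ?thesis using E_scale a' by metis
  qed
  have constr_E: "constructible (\<lambda>e. E (e 0) (e 1))"
  proof (cases "finite K")
    case True
    \<comment> \<open>Here \<open>d\<close> is the base variable and \<open>a\<close> the fibre
      variable; the third argument is a dummy.\<close>
    have "constructible (\<lambda>e. (\<lambda>x y z. E y x) (e 0) (e 1) (e 2))"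
    proof (rule constructible_of_inf_constr_fibres)
      show "inf_constr (\<lambda>e. E (e 1) (e 0))" by (intro inf_E polyfun_var)
      show "constructible (\<lambda>e. (\<lambda>x z. x \<in> Q) (e 0) (e 1))"
        by (intro constructible_mem[OF Q(1)] polyfun_var)
      show "constructible (\<lambda>e. \<exists>k\<in>K. e 0 = k * e 1)"
        by (intro constructible_Bex_finite[OF True] constructible_eq polyfun_mult polyfun_var polyfun_const)
      show "\<exists>k\<in>K. y = k * y'" if "E y x" "E y' x" for x y y'
        using E_ratio[OF that] E_nz[OF that(2)] by (intro bexI[of _ "y / y'"]) auto
      show "E y x" if "\<exists>k\<in>K. y = k * y'" "E y' x" for x y y'
        using that E_scale by blast
    qed (auto simp: Q_def)
    then have "constructible (\<lambda>e. (\<lambda>x y. E y x) (e 0) (e 1))" .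
    from constructible_subst2[where Q = "\<lambda>x y. E y x", OF this, of "\<lambda>e. e 1" "\<lambda>e. e 0"]
    show ?thesis by (simp add: polyfun_var)
  next
    case False
    then have "K = - {0}" using K(1) by blast
    have "E a d \<longleftrightarrow> a \<noteq> 0 \<and> d \<in> Q" for a d
    proof
      assume *: "a \<noteq> 0 \<and> d \<in> Q"
      then obtain a' where a': "E a' d" unfolding Q_def by blast
      then have "a / a' \<in> K" "a = a / a' * a'" using * E_nz \<open>K = - {0}\<close> by auto
      then show "E a d" using E_scale[OF _ a'] by metis
    qed (use E_nz Q_def in blast)
    moreover have "constructible (\<lambda>e. e 0 \<noteq> 0 \<and> e 1 \<in> Q)"
      by (intro constructible_and constructible_not constructible_zero constructible_mem[OF Q(1)] polyfun_var)
    ultimately show ?thesis by simp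
  qed
  have "inf_constr (\<lambda>e. H 1 (e 0) 1)" by (intro inf_constr_H polyfun_var polyfun_const)
  then have "tame L" unfolding L_def by (rule inf_constr_tame)
  moreover have "0 \<in> L" using H_one by (simp add: L_def)
  moreover have "x + y \<in> L" if "x \<in> L" "y \<in> L" for x y
    using H_mult[of 1 y 1 1 x 1] that by (simp add: L_def)
  ultimately consider "L = {0}" | "L = UNIV" using tame_add_closed by blast
  then show ?thesis
  proof cases
    case 1
    show ?thesis
    \<comment> \<open>With trivial unipotent part, \<open>b\<close> is a function of
      \<open>a\<close> and \<open>d\<close>, so the fibre relation is equality.\<close>
    proof (rule constructible_of_inf_constr_fibres[where B = E and R = "(=)"])
      show "inf_constr (\<lambda>e. H (e 0) (e 1) (e 2))" by (intro inf_constr_H polyfun_var)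
      show "constructible (\<lambda>e. e 0 = e 1)" by (intro constructible_eq polyfun_var)
      show "constructible (\<lambda>e. E (e 0) (e 1))" by (rule constr_E)
      show "b = b'" if b: "H a b d" "H a b' d" for a b b' d
      proof -
        have "E a d" using b unfolding E_def by blast
        then have nz: "a \<noteq> 0" "d \<noteq> 0" and "E (inverse a) (inverse d)" using E_nz E_inverse by auto
        then obtain b'' where b'': "H (inverse a) b'' (inverse d)" unfolding E_def by blast
        have "a * b'' + b * inverse d \<in> L" "a * b'' + b' * inverse d \<in> L"
          using H_mult[OF b(1) b''] H_mult[OF b(2) b''] nz by (auto simp: L_def)
        then have "b * inverse d = b' * inverse d" unfolding 1 by (metis add_left_cancel singletonD)
        then show ?thesis using nz by simp
      qed
    qed (auto simp: E_def)
  next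
    case 2
    have "H a b d \<longleftrightarrow> E a d" for a b d
    proof
      assume "E a d"
      then obtain b' where b': "H a b' d" unfolding E_def by blast
      \<comment> \<open>Multiplying by this unipotent matrix moves the off-diagonal entry from
        \<open>b'\<close> to \<open>b\<close>.\<close>
      have "H 1 ((b - b') / d) 1" using 2 by (auto simp: L_def)
      from H_mult[OF this b'] show "H a b d" using E_nz[OF \<open>E a d\<close>] by simp
    qed (auto simp: E_def)
    then show ?thesis using constructible_subst2[OF constr_E polyfun_var polyfun_var, of 0 2] by simp
  qed
qed

lemma constructible_H_comp:
  "polyfun f \<Longrightarrow> polyfun g \<Longrightarrow> polyfun h \<Longrightarrow> constructible (\<lambda>e. H (f e) (g e) (h e))"
  by (rule constructible_subst3[OF constructible_H])

section \<open>Definable hulls of the rank-one and nilpotent parts\<close>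

lemma row_scalars_mult: "a \<in> A \<Longrightarrow> a' \<in> A \<Longrightarrow> a * a' \<in> A"
  using mult[of a _ 0 a' _ 0] unfolding row_scalars_def by fastforce

lemma
  shows row_scalars_cases: "finite A \<or> A = - {0}"
    and one_in_row_scalars: "a \<in> A \<Longrightarrow> 1 \<in> A"
    and inverse_in_row_scalars: "a \<in> A \<Longrightarrow> inverse a \<in> A"
proof -
  have "inf_constr (\<lambda>e. e 0 \<noteq> 0 \<and> (\<exists>b. m (e 0) b 0))"
    by (intro inf_constr_and inf_constr_ex inf_constr_m constructible_imp_inf_constr constructible_not
        constructible_zero polyfun_var polyfun_const)
  then have "tame A" unfolding row_scalars_def by (rule inf_constr_tame)
  moreover have "0 \<notin> A" by (simp add: row_scalars_def)
  ultimately have *: "(finite A \<or> A = - {0}) \<and> 1 \<in> A \<and> (\<forall>x\<in>A. inverse x \<in> A)" if "A \<noteq> {}"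
    using tame_mult_closed[of A] row_scalars_mult that by blast
  then show "finite A \<or> A = - {0}" by (cases "A = {}") auto
  show "a \<in> A \<Longrightarrow> 1 \<in> A" and "a \<in> A \<Longrightarrow> inverse a \<in> A" using * by blast+
qed

text \<open>A unit times a row with upper-left entry \<open>1\<close> is a row whose upper-left
  entry is that of the unit.\<close>

lemma H_in_row_scalars: "H x y z \<Longrightarrow> a \<in> A \<Longrightarrow> x \<in> A"
  using one_in_row_scalars[of a] mult[of x y z 1 _ 0]
  unfolding row_scalars_def units_of_tri_def by fastforce

lemma row_stable_self: "row_stable m (\<lambda>a b. a \<noteq> 0 \<and> m a b 0)"
  unfolding row_stable_def
proof (intro allI impI conjI ballI)
  fix a b assume ab: "a \<noteq> 0 \<and> m a b 0"
  then show "a \<in> A" by (auto simp: row_scalars_def)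
  show "t * a \<noteq> 0" "m (t * a) (t * b) 0" if "t \<in> A" for t
    using that ab mult[of t _ 0 a b 0] by (auto simp: row_scalars_def)
  show "a * x \<noteq> 0" "m (a * x) (a * y + b * z) 0" if "H x y z" for x y z
    using that ab mult[of a b 0 x y z] by (auto simp: units_of_tri_def)
qed

text \<open>Take all rows whose whole orbit under scaling by \<open>A\<close> and right
  multiplication by units stays in \<open>U\<close>. This is definable since \<open>H\<close> is
  constructible and \<open>A\<close> is finite or all of the nonzero numbers; it is stable because
  both act as monoids.\<close>

lemma row_stable_hull:
  assumes U: "constructible (\<lambda>e. U (e 0) (e 1))"
    and mU: "\<And>a b. a \<noteq> 0 \<Longrightarrow> m a b 0 \<Longrightarrow> U a b"
  shows "\<exists>X. constructible (\<lambda>e. X (e 0) (e 1)) \<and> row_stable m X \<and>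
    (\<forall>a b. a \<noteq> 0 \<longrightarrow> m a b 0 \<longrightarrow> X a b) \<and> (\<forall>a b. X a b \<longrightarrow> U a b)"
proof (intro exI conjI allI impI)
  define X where "X a b \<longleftrightarrow> a \<in> A \<and> (\<forall>t x y z. t \<in> A \<longrightarrow> H x y z \<longrightarrow> U (t * a * x) (t * (a * y + b * z)))"
    for a b
  show "constructible (\<lambda>e. X (e 0) (e 1))"
    unfolding X_def
    by (intro constructible_and constructible_all constructible_imp constructible_mem[OF row_scalars_cases]
        constructible_H_comp constructible_subst2[OF U] polyfun_mult polyfun_add polyfun_var)
  show "row_stable m X"
    unfolding row_stable_def
  proof (intro allI impI conjI ballI)
    fix a b assume ab: "X a b"
    then show "a \<in> A" by (simp add: X_def)
    show "X (t * a) (t * b)" if t: "t \<in> A" for t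
      unfolding X_def
    proof (intro conjI allI impI)
      show "t * a \<in> A" using t \<open>a \<in> A\<close> by (rule row_scalars_mult)
      fix t' x y z assume "t' \<in> A" "H x y z"
      then have "U (t' * t * a * x) (t' * t * (a * y + b * z))"
        using ab row_scalars_mult[OF _ t] unfolding X_def by blast
      then show "U (t' * (t * a) * x) (t' * (t * a * y + t * b * z))"
        by (simp add: algebra_simps)
    qed
    show "X (a * x) (a * y + b * z)" if h: "H x y z" for x y z
      unfolding X_def
    proof (intro conjI allI impI)
      show "a * x \<in> A" using H_in_row_scalars[OF h \<open>a \<in> A\<close>] \<open>a \<in> A\<close> by (intro row_scalars_mult)
      fix t x' y' z' assume "t \<in> A" "H x' y' z'"
      then have "U (t * a * (x * x')) (t * (a * (x * y' + y * z') + b * (z * z')))"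
        using ab H_mult[OF h] unfolding X_def by blast
      then show "U (t * (a * x) * x') (t * (a * x * y' + (a * y + b * z) * z'))"
        by (simp add: algebra_simps)
    qed
  qed
  show "X a b" if ab: "a \<noteq> 0" "m a b 0" for a b
    unfolding X_def
  proof (intro conjI allI impI)
    show "a \<in> A" using ab by (auto simp: row_scalars_def)
    fix t x y z assume t: "t \<in> A" and h: "H x y z"
    have "X' (t * (a * x)) (t * (a * y + b * z))" if "X' = (\<lambda>a b. a \<noteq> 0 \<and> m a b 0)" for X'
      using row_stable_self ab t h unfolding row_stable_def that by blast
    then show "U (t * a * x) (t * (a * y + b * z))" using mU by (simp add: mult.assoc)
  qed
  show "U a b" if "X a b" for a b
  proof -
    have "a \<in> A" using that by (simp add: X_def)
    then have "U (1 * a * 1) (1 * (a * 0 + b * 1))"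
      using that one_in_row_scalars H_one unfolding X_def by blast
    then show ?thesis by simp
  qed
qed

text \<open>The mirrored scalars: lower-right entries of the rank-one matrices with
  \<open>a = 0\<close>, whose kernel is the first coordinate axis. These are the columns
  below.\<close>

abbreviation "D \<equiv> row_scalars (\<lambda>a b d. m d b a)"

text \<open>Units, rows and columns multiply a nilpotent on either side into a multiple of itself,
  so the hull consists of all \<open>b\<close> whose orbit under the scalars involved stays in
  \<open>U\<close>.\<close>

lemma nilpotent_hull:
  assumes U: "constructible (\<lambda>e. U (e 0))" and mU: "\<And>b. m 0 b 0 \<Longrightarrow> U b"
  shows "\<exists>N. constructible (\<lambda>e. N (e 0)) \<and> (\<forall>b. m 0 b 0 \<longrightarrow> N b) \<and> (\<forall>b. N b \<longrightarrow> U b) \<and>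
    (\<forall>b k. N b \<longrightarrow> k \<in> A \<union> D \<longrightarrow> N (k * b)) \<and>
    (\<forall>b x y z. N b \<longrightarrow> H x y z \<longrightarrow> N (x * b) \<and> N (z * b))"
proof -
  interpret M: tri_monoid "\<lambda>a b d. m d b a" by (rule tri_monoid_mirror)
  \<comment> \<open>Adjoining \<open>1\<close> covers the case that there are no rows or no columns:
    the orbit of a point then always contains the point itself.\<close>
  define A1 where "A1 = insert 1 A"
  define D1 where "D1 = insert 1 D"
  define P where "P = {x. \<exists>y z. H x y z}"
  define R where "R = {z. \<exists>x y. H x y z}"
  have insert_one: "finite (insert 1 S) \<or> insert 1 S = - {0}" if "finite S \<or> S = - {0}" for S :: "complex set"
    using that by auto
  have A1: "finite A1 \<or> A1 = - {0}" unfolding A1_def by (rule insert_one[OF row_scalars_cases])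
  have D1: "finite D1 \<or> D1 = - {0}" unfolding D1_def by (rule insert_one[OF M.row_scalars_cases])
  have constr_P: "constructible (\<lambda>e. f e \<in> P)" if "polyfun f" for f
  proof -
    have "constructible (\<lambda>e. \<exists>y z. H (e 0) y z)"
      by (intro constructible_ex constructible_H_comp polyfun_var)
    from constructible_subst1[OF this that] show ?thesis by (simp add: P_def)
  qed
  have constr_R: "constructible (\<lambda>e. f e \<in> R)" if "polyfun f" for f
  proof -
    have "constructible (\<lambda>e. \<exists>x y. H x y (e 0))"
      by (intro constructible_ex constructible_H_comp polyfun_var)
    from constructible_subst1[OF this that] show ?thesis by (simp add: R_def)
  qed
  have A1_mult: "k * l \<in> A1" if "k \<in> A1" "l \<in> A1" for k l
    using that row_scalars_mult by (auto simp: A1_def)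
  have D1_mult: "k * l \<in> D1" if "k \<in> D1" "l \<in> D1" for k l
    using that M.row_scalars_mult by (auto simp: D1_def)
  have P_mult: "k * l \<in> P" if "k \<in> P" "l \<in> P" for k l
    using that H_mult unfolding P_def by blast
  have R_mult: "k * l \<in> R" if "k \<in> R" "l \<in> R" for k l
    using that H_mult unfolding R_def by blast
  have ones: "1 \<in> A1" "1 \<in> D1" "1 \<in> P" "1 \<in> R"
    using H_one by (auto simp: A1_def D1_def P_def R_def)
  define N where "N b \<longleftrightarrow> (\<forall>k l p r. k \<in> A1 \<longrightarrow> l \<in> D1 \<longrightarrow> p \<in> P \<longrightarrow> r \<in> R \<longrightarrow> U (k * l * p * r * b))" for b
  have N_D: "U (k * l * p * r * b)" if "N b" "k \<in> A1" "l \<in> D1" "p \<in> P" "r \<in> R" for k l p r b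
    using that unfolding N_def by blast
  have NA: "N (s * b)" if "N b" "s \<in> A1" for b s
    unfolding N_def
  proof (intro allI impI)
    fix k l p r assume "k \<in> A1" "l \<in> D1" "p \<in> P" "r \<in> R"
    then have "U (k * s * l * p * r * b)" using that by (intro N_D A1_mult)
    then show "U (k * l * p * r * (s * b))" by (simp add: mult_ac)
  qed
  have ND: "N (s * b)" if "N b" "s \<in> D1" for b s
    unfolding N_def
  proof (intro allI impI)
    fix k l p r assume "k \<in> A1" "l \<in> D1" "p \<in> P" "r \<in> R"
    then have "U (k * (l * s) * p * r * b)" using that by (intro N_D D1_mult)
    then show "U (k * l * p * r * (s * b))" by (simp add: mult_ac)
  qed
  have NP: "N (s * b)" if "N b" "s \<in> P" for b s
    unfolding N_def
  proof (intro allI impI)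
    fix k l p r assume "k \<in> A1" "l \<in> D1" "p \<in> P" "r \<in> R"
    then have "U (k * l * (p * s) * r * b)" using that by (intro N_D P_mult)
    then show "U (k * l * p * r * (s * b))" by (simp add: mult_ac)
  qed
  have NR: "N (s * b)" if "N b" "s \<in> R" for b s
    unfolding N_def
  proof (intro allI impI)
    fix k l p r assume "k \<in> A1" "l \<in> D1" "p \<in> P" "r \<in> R"
    then have "U (k * l * p * (r * s) * b)" using that by (intro N_D R_mult)
    then show "U (k * l * p * r * (s * b))" by (simp add: mult_ac)
  qed
  have mA: "m 0 (k * b) 0" if "m 0 b 0" "k \<in> A1" for k b
    using that mult[of k _ 0 0 b 0] unfolding A1_def row_scalars_def by auto
  have mD: "m 0 (k * b) 0" if "m 0 b 0" "k \<in> D1" for k b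
    using that mult[of 0 b 0 0 _ k] unfolding D1_def row_scalars_def by (auto simp: mult.commute)
  have mP: "m 0 (k * b) 0" if "m 0 b 0" "k \<in> P" for k b
    using that mult[of k _ _ 0 b 0] unfolding P_def units_of_tri_def by auto
  have mR: "m 0 (k * b) 0" if "m 0 b 0" "k \<in> R" for k b
    using that mult[of 0 b 0 _ _ k] unfolding R_def units_of_tri_def by (auto simp: mult.commute)
  show ?thesis
  proof (intro exI[of _ N] conjI allI impI)
    show "constructible (\<lambda>e. N (e 0))"
      unfolding N_def
      by (intro constructible_all constructible_imp constructible_mem[OF A1] constructible_mem[OF D1]
          constr_P constr_R constructible_subst1[OF U] polyfun_mult polyfun_var)
    show "N b" if "m 0 b 0" for b
      unfolding N_def
    proof (intro allI impI)
      fix k l p r assume "k \<in> A1" "l \<in> D1" "p \<in> P" "r \<in> R"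
      then have "m 0 (k * (l * (p * (r * b)))) 0" using that by (intro mA mD mP mR)
      then show "U (k * l * p * r * b)" using mU by (simp add: mult.assoc)
    qed
    show "U b" if "N b" for b using N_D[OF that ones] by simp
    show "N (k * b)" if "N b" "k \<in> A \<union> D" for k b
      using that NA ND by (auto simp: A1_def D1_def)
    show "N (x * b)" if "N b" "H x y z" for x y z b
      using that by (intro NP) (auto simp: P_def)
    show "N (z * b)" if "N b" "H x y z" for x y z b
      using that by (intro NR) (auto simp: R_def)
  qed
qed

text \<open>Units are kept, and nilpotents, rows and columns are enlarged to their hulls. A column
  times a row is zero, so only a row times a column is not controlled by stability: it is a
  nilpotent that has to lie in \<open>N\<close>.\<close>

lemma tri_monoid_hull_aux:
  assumes U: "constructible (\<lambda>e. U (e 0) (e 1) (e 2))" and mU: "\<And>a b d. m a b d \<Longrightarrow> U a b d"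
    and zero: "m 0 0 0"
    and alt: "(\<forall>b. m 0 b 0) \<or> finite {(a, b). a \<noteq> 0 \<and> m a b 0}"
  shows "\<exists>m'. constructible (\<lambda>e. m' (e 0) (e 1) (e 2)) \<and> (\<forall>a b d. m a b d \<longrightarrow> m' a b d) \<and>
    (\<forall>a b d. m' a b d \<longrightarrow> U a b d) \<and> (\<forall>a b d a' b' d'. m' a b d \<longrightarrow> m' a' b' d' \<longrightarrow>
      m' (a * a') (a * b' + b * d') (d * d'))"
proof -
  interpret M: tri_monoid "\<lambda>a b d. m d b a" by (rule tri_monoid_mirror)
  have U_comp: "constructible (\<lambda>e. U (f e) (g e) (h e))" if "polyfun f" "polyfun g" "polyfun h" for f g h
    using constructible_subst3[OF U that] .
  obtain N where constr_N: "constructible (\<lambda>e. N (e 0))" and mN: "\<And>b. m 0 b 0 \<Longrightarrow> N b"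
    and NU: "\<And>b. N b \<Longrightarrow> U 0 b 0" and NAD: "\<And>b k. N b \<Longrightarrow> k \<in> A \<union> D \<Longrightarrow> N (k * b)"
    and NH: "\<And>b x y z. N b \<Longrightarrow> H x y z \<Longrightarrow> N (x * b) \<and> N (z * b)"
    using nilpotent_hull[of "\<lambda>b. U 0 b 0"] U_comp polyfun_var polyfun_const mU by blast
  \<comment> \<open>The last clause tests \<open>X\<close> only against matrices already in
    \<open>m\<close>. It guarantees that the columns of \<open>m\<close> satisfy the constraint
    imposed on \<open>Y\<close> below. If all nilpotents occur it is void; otherwise the finitely
    many rows are kept unchanged.\<close>
  have "\<exists>X. constructible (\<lambda>e. X (e 0) (e 1)) \<and> row_stable m X \<and>
      (\<forall>a b. a \<noteq> 0 \<longrightarrow> m a b 0 \<longrightarrow> X a b) \<and> (\<forall>a b. X a b \<longrightarrow> U a b 0) \<and>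
      (\<forall>a b b' d'. X a b \<longrightarrow> m 0 b' d' \<longrightarrow> N (a * b' + b * d'))"
  proof (cases "\<forall>b. m 0 b 0")
    case True
    then have "N b" for b using mN by blast
    moreover have "constructible (\<lambda>e. U (e 0) (e 1) 0)" by (intro U_comp polyfun_var polyfun_const)
    then obtain X where "constructible (\<lambda>e. X (e 0) (e 1)) \<and> row_stable m X \<and>
        (\<forall>a b. a \<noteq> 0 \<longrightarrow> m a b 0 \<longrightarrow> X a b) \<and> (\<forall>a b. X a b \<longrightarrow> U a b 0)"
      using row_stable_hull[of "\<lambda>a b. U a b 0"] mU by blast
    ultimately show ?thesis by (intro exI[of _ X]) simp
  next
    case False
    then have fin: "finite {(a, b). a \<noteq> 0 \<and> m a b 0}" using alt by blast
    have "constructible (\<lambda>e. \<exists>p\<in>{(a, b). a \<noteq> 0 \<and> m a b 0}. e 0 = fst p \<and> e 1 = snd p)"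
      by (intro constructible_Bex_finite[OF fin] constructible_and constructible_eq polyfun_var polyfun_const)
    moreover have "N (a * b' + b * d')" if "m a b 0" "m 0 b' d'" for a b b' d'
      using mult[OF that] mN by simp
    ultimately show ?thesis
      using row_stable_self mU by (intro exI[of _ "\<lambda>a b. a \<noteq> 0 \<and> m a b 0"]) auto
  qed
  then obtain X where constr_X: "constructible (\<lambda>e. X (e 0) (e 1))" and X: "row_stable m X"
    and mX: "\<And>a b. a \<noteq> 0 \<Longrightarrow> m a b 0 \<Longrightarrow> X a b" and XU: "\<And>a b. X a b \<Longrightarrow> U a b 0"
    and XN: "\<And>a b b' d'. X a b \<Longrightarrow> m 0 b' d' \<Longrightarrow> N (a * b' + b * d')" by blast
  \<comment> \<open>The mirrored hull is taken inside the columns whose product with every row in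
    \<open>X\<close> lies in \<open>N\<close>, so that \<open>Y\<close> inherits this
    condition.\<close>
  have "constructible (\<lambda>e. U 0 (e 1) (e 0) \<and> (\<forall>a b. X a b \<longrightarrow> N (a * e 1 + b * e 0)))"
    by (intro constructible_and constructible_all constructible_imp U_comp constructible_subst2[OF constr_X]
        constructible_subst1[OF constr_N] polyfun_add polyfun_mult polyfun_var polyfun_const)
  then obtain Y where constr_Y: "constructible (\<lambda>e. Y (e 0) (e 1))"
    and Y: "row_stable (\<lambda>a b d. m d b a) Y"
    and mY: "\<And>d b. d \<noteq> 0 \<Longrightarrow> m 0 b d \<Longrightarrow> Y d b"
    and YU: "\<And>d b. Y d b \<Longrightarrow> U 0 b d \<and> (\<forall>a' b'. X a' b' \<longrightarrow> N (a' * b + b' * d))"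
    using M.row_stable_hull[of "\<lambda>d b. U 0 b d \<and> (\<forall>a' b'. X a' b' \<longrightarrow> N (a' * b + b' * d))"] mU XN
    by blast
  have X_D: "a \<in> A" "t \<in> A \<Longrightarrow> X (t * a) (t * b)" "H x y z \<Longrightarrow> X (a * x) (a * y + b * z)"
    if "X a b" for a b t x y z
    using X that unfolding row_stable_def by blast+
  have Y_D: "d \<in> D" "t \<in> D \<Longrightarrow> Y (t * d) (t * b)" "H x y z \<Longrightarrow> Y (z * d) (x * b + y * d)"
    if "Y d b" for d b t x y z
  proof -
    show "d \<in> D" "t \<in> D \<Longrightarrow> Y (t * d) (t * b)" using Y that unfolding row_stable_def by blast+
    assume "H x y z"
    then have "units_of_tri (\<lambda>a b d. m d b a) z y x" by (simp add: units_of_tri_def)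
    then have "Y (d * z) (d * y + b * x)" using Y that unfolding row_stable_def by blast
    then show "Y (z * d) (x * b + y * d)" by (simp add: mult.commute add.commute)
  qed
  have H_D: "z \<in> D" if "H x y z" "d \<in> D" for x y z d
    using M.H_in_row_scalars[of z y x d] that by (simp add: units_of_tri_def)
  have N0: "N 0" using mN zero by blast
  define m' where "m' a b d \<longleftrightarrow> H a b d \<or> a = 0 \<and> d = 0 \<and> N b \<or> d = 0 \<and> X a b \<or> a = 0 \<and> Y d b" for a b d
  show ?thesis
  proof (intro exI[of _ m'] conjI allI impI)
    show "constructible (\<lambda>e. m' (e 0) (e 1) (e 2))"
      unfolding m'_def
      by (intro constructible_or constructible_and constructible_H_comp constructible_zero
          constructible_subst1[OF constr_N] constructible_subst2[OF constr_X]
          constructible_subst2[OF constr_Y] polyfun_var)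
    show "m' a b d" if "m a b d" for a b d
      using that mN mX mY unfolding m'_def units_of_tri_def by (cases "a = 0"; cases "d = 0") auto
    show "U a b d" if "m' a b d" for a b d
      using that NU XU YU mU unfolding m'_def units_of_tri_def by auto
    fix a b d a' b' d' assume 1: "m' a b d" and 2: "m' a' b' d'"
    from 1 consider (h) "H a b d" | (n) "a = 0" "d = 0" "N b" | (x) "d = 0" "X a b" | (y) "a = 0" "Y d b"
      unfolding m'_def by blast
    then show "m' (a * a') (a * b' + b * d') (d * d')"
    proof cases
      case h
      from 2 show ?thesis unfolding m'_def
        using H_mult[OF h, of a' b' d'] NH[OF _ h, of b'] X_D(1)[of a' b'] X_D(2)[of a' b' a] H_in_row_scalars[OF h, of a']
          Y_D(3)[OF _ h, of d' b'] by auto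
    next
      case n
      from 2 show ?thesis unfolding m'_def
        using n NH[of b a' b' d'] NAD[of b d'] N0 Y_D(1)[of d' b'] by (auto simp: mult.commute)
    next
      case x
      from 2 show ?thesis unfolding m'_def
        using x X_D[OF x(2)] NAD[of b' a] X_D(2)[of a' b' a] YU[of d' b'] by auto
    next
      case y
      from 2 show ?thesis unfolding m'_def
        using y N0 Y_D(1)[OF y(2)] Y_D(2)[OF y(2), of d'] H_D[of a' b' d' d] Y_D(1)[of d' b']
        by (auto simp: mult.commute)
    qed
  qed
qed

text \<open>Left multiplication by a row with entry \<open>inverse a\<close> normalizes the
  upper-left entry to \<open>1\<close>. With finitely many values of \<open>a\<close>, infinitely
  many normalized rows remain, and a tame infinite set has small complement.\<close>

lemma infinite_row_cosmall:
  assumes "infinite {(a, b). a \<noteq> 0 \<and> m a b 0}" "finite A"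
  shows "- {b. m 1 b 0} \<prec> (UNIV :: complex set)"
proof -
  have "{(a, b). a \<noteq> 0 \<and> m a b 0} \<subseteq> (\<lambda>(a, b). (a, a * b)) ` (A \<times> {b. m 1 b 0})"
  proof safe
    fix a b assume ab: "a \<noteq> 0" "m a b 0"
    then have "a \<in> A" by (auto simp: row_scalars_def)
    then obtain c where "m (inverse a) c 0" using inverse_in_row_scalars by (auto simp: row_scalars_def)
    from mult[OF this ab(2)] have "m 1 (b / a) 0" using ab(1) by (simp add: field_simps)
    then show "(a, b) \<in> (\<lambda>(a, b). (a, a * b)) ` (A \<times> {b. m 1 b 0})"
      using ab(1) \<open>a \<in> A\<close> by (intro image_eqI[of _ _ "(a, b / a)"]) auto
  qed
  then have "infinite {b. m 1 b 0}"
    using assms finite_subset by blast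
  moreover have "inf_constr (\<lambda>e. m 1 (e 0) 0)" by (intro inf_constr_m polyfun_var polyfun_const)
  then have "tame {b. m 1 b 0}" by (rule inf_constr_tame)
  ultimately show ?thesis by (simp add: tame_def)
qed

text \<open>If all nonzero scalars occurred in rows, a row with scalar \<open>p / c\<close> would
  turn the nilpotent \<open>c\<close> into \<open>p\<close>.\<close>

lemma row_scalars_finite_or_nilpotent:
  assumes "m 0 c 0" "c \<noteq> 0" "m 0 0 0" "\<not> m 0 p 0"
  shows "finite A"
proof (rule ccontr)
  assume "infinite A"
  moreover have "p \<noteq> 0" using assms by auto
  ultimately have "p / c \<in> A" using row_scalars_cases assms(2) by auto
  then obtain b where "m (p / c) b 0" by (auto simp: row_scalars_def)
  from mult[OF this assms(1)] show False using assms by simp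
qed

text \<open>The alternative required by \<open>tri_monoid_hull_aux\<close> holds for
  \<open>m\<close> or for its mirror image, and a hull of the mirror image can be mirrored
  back.\<close>

lemma tri_monoid_hull:
  assumes U: "constructible (\<lambda>e. U (e 0) (e 1) (e 2))" and mU: "\<And>a b d. m a b d \<Longrightarrow> U a b d"
    and zero: "m 0 0 0" and c: "m 0 c 0" "c \<noteq> 0"
  shows "\<exists>m'. constructible (\<lambda>e. m' (e 0) (e 1) (e 2)) \<and> (\<forall>a b d. m a b d \<longrightarrow> m' a b d) \<and>
    (\<forall>a b d. m' a b d \<longrightarrow> U a b d) \<and> (\<forall>a b d a' b' d'. m' a b d \<longrightarrow> m' a' b' d' \<longrightarrow>
      m' (a * a') (a * b' + b * d') (d * d'))"
proof -
  interpret M: tri_monoid "\<lambda>a b d. m d b a" by (rule tri_monoid_mirror)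
  \<comment> \<open>If both kinds of rank-one matrices are infinite in number, then the normalized ones fill \<open>\<complex>\<close>
    up to small sets, so their off-diagonal entries have every complex number as a sum.\<close>
  consider "(\<forall>b. m 0 b 0) \<or> finite {(a, b). a \<noteq> 0 \<and> m a b 0}" | "finite {(d, b). d \<noteq> 0 \<and> m 0 b d}"
  proof -
    have False if inf: "infinite {(a, b). a \<noteq> 0 \<and> m a b 0}" "infinite {(d, b). d \<noteq> 0 \<and> m 0 b d}"
      and p: "\<not> m 0 p 0" for p
    proof -
      have "finite A" using c zero p by (rule row_scalars_finite_or_nilpotent)
      then have G: "- {b. m 1 b 0} \<prec> (UNIV :: complex set)" using inf(1) by (intro infinite_row_cosmall)
      have "finite D" using c zero p by (rule M.row_scalars_finite_or_nilpotent)
      then have F: "- {b. m 0 b 1} \<prec> (UNIV :: complex set)" using inf(2) by (intro M.infinite_row_cosmall)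
      have "- {b. m 0 b 1} \<union> (\<lambda>y. p - y) ` (- {b. m 1 b 0}) \<prec> (UNIV :: complex set)"
        by (intro Un_small image_small F G)
      then have "- {b. m 0 b 1} \<union> (\<lambda>y. p - y) ` (- {b. m 1 b 0}) \<noteq> UNIV" using lesspoll_not_refl by metis
      then obtain x where x: "m 0 x 1" "x \<notin> (\<lambda>y. p - y) ` (- {b. m 1 b 0})" by blast
      moreover have "p - (p - x) = x" by simp
      ultimately have "m 1 (p - x) 0" by (metis (mono_tags, lifting) ComplI image_eqI mem_Collect_eq)
      from mult[OF this x(1)] show False using p by simp
    qed
    then show thesis using that by blast
  qed
  then show ?thesis
  proof cases
    case 1
    then show ?thesis using tri_monoid_hull_aux[OF U mU zero] by blast
  next
    case 2
    have "constructible (\<lambda>e. U (e 2) (e 1) (e 0))"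
      by (intro constructible_subst3[OF U] polyfun_var)
    then have "\<exists>m'. constructible (\<lambda>e. m' (e 0) (e 1) (e 2)) \<and> (\<forall>a b d. m d b a \<longrightarrow> m' a b d) \<and>
        (\<forall>a b d. m' a b d \<longrightarrow> U d b a) \<and> (\<forall>a b d a' b' d'. m' a b d \<longrightarrow> m' a' b' d' \<longrightarrow>
          m' (a * a') (a * b' + b * d') (d * d'))"
      using mU zero 2 by (intro M.tri_monoid_hull_aux) simp_all
    then obtain m' where
      constr: "constructible (\<lambda>e. m' (e 0) (e 1) (e 2))" and mm': "\<And>a b d. m d b a \<Longrightarrow> m' a b d"
      and m'U: "\<And>a b d. m' a b d \<Longrightarrow> U d b a"
      and mult': "\<And>a b d a' b' d'. m' a b d \<Longrightarrow> m' a' b' d' \<Longrightarrow> m' (a * a') (a * b' + b * d') (d * d')"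
      by blast
    show ?thesis
    proof (intro exI[of _ "\<lambda>a b d. m' d b a"] conjI allI impI)
      show "constructible (\<lambda>e. m' (e 2) (e 1) (e 0))"
        by (intro constructible_subst3[OF constr] polyfun_var)
      show "m' (d * d') (a * b' + b * d') (a * a')" if "m' d b a" "m' d' b' a'" for a b d a' b' d'
        using mult'[OF that(2,1)] by (simp add: mult.commute add.commute)
    qed (use mm' m'U in auto)
  qed
qed

end

section \<open>Matrices\<close>

definition mat4 :: "complex \<Rightarrow> complex \<Rightarrow> complex \<Rightarrow> complex \<Rightarrow> complex^2^2" where
  "mat4 a b c d = vector [vector [a, b], vector [c, d]]"

lemma mat4_nth [simp]:
  "mat4 a b c d $ 1 $ 1 = a" "mat4 a b c d $ 1 $ 2 = b"
  "mat4 a b c d $ 2 $ 1 = c" "mat4 a b c d $ 2 $ 2 = d"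
  by (simp_all add: mat4_def)

lemma mat4_eq_iff: "A = mat4 a b c d \<longleftrightarrow> A $ 1 $ 1 = a \<and> A $ 1 $ 2 = b \<and> A $ 2 $ 1 = c \<and> A $ 2 $ 2 = d"
  by (auto simp: vec_eq_iff forall_2)

lemma mat4_mult:
  "mat4 a b c d ** mat4 a' b' c' d' = mat4 (a * a' + b * c') (a * b' + b * d') (c * a' + d * c') (c * b' + d * d')"
  by (simp add: mat4_eq_iff matrix_matrix_mult_def sum_2)

lemma mat_1_eq_mat4: "mat 1 = mat4 1 0 0 1"
  by (simp add: mat4_eq_iff mat_def)

lemma polyfun_nth4:
  assumes "polyfun a" "polyfun b" "polyfun c" "polyfun d"
  shows "polyfun (\<lambda>e. [a e, b e, c e, d e] ! i)"
proof -
  consider "i = 0" | "i = 1" | "i = 2" | "i = 3" | j where "i = Suc (Suc (Suc (Suc j)))"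
    by (metis One_nat_def Suc_1 eval_nat_numeral(3) not0_implies_Suc)
  then show ?thesis by cases (simp_all add: assms polyfun_const)
qed

section \<open>Definable sets of matrices as constructible predicates of the entries\<close>

lemma definable_mat_iff_constructible:
  "definable_mat X \<longleftrightarrow> constructible (\<lambda>e. mat4 (e 0) (e 1) (e 2) (e 3) \<in> X)"
proof
  assume "definable_mat X"
  then obtain p where p: "entries ` X = {xs. length xs = 4 \<and> sat (\<lambda>i. xs ! i) p}"
    unfolding definable_mat_def definable_def by blast
  have inj: "inj entries" by (auto simp: inj_def entries_def vec_eq_iff forall_2)
  have "mat4 a b c d \<in> X \<longleftrightarrow> sat (\<lambda>i. [a, b, c, d] ! i) p" for a b c d
  proof -
    have "mat4 a b c d \<in> X \<longleftrightarrow> [a, b, c, d] \<in> entries ` X"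
      using inj_image_mem_iff[OF inj, of "mat4 a b c d" X] by (simp add: entries_def)
    then show ?thesis unfolding p by simp
  qed
  moreover have "constructible (\<lambda>e. sat (\<lambda>i. [e 0, e 1, e 2, e 3] ! i) p)"
    by (intro constructible_subst[OF constructible_sat] polyfun_nth4 polyfun_var)
  ultimately show "constructible (\<lambda>e. mat4 (e 0) (e 1) (e 2) (e 3) \<in> X)" by simp
next
  assume "constructible (\<lambda>e. mat4 (e 0) (e 1) (e 2) (e 3) \<in> X)"
  then obtain p where p: "free_vars p \<subseteq> {..<4}" "\<And>e. sat e p \<longleftrightarrow> mat4 (e 0) (e 1) (e 2) (e 3) \<in> X"
  proof -
    from constructible_imp_sat[OF \<open>constructible _\<close>, of 4]
    obtain p where p: "free_vars p \<subseteq> {..<4}" "\<And>e. sat e p = (mat4 (if (0::nat) < 4 then e 0 else 0)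
        (if (1::nat) < 4 then e 1 else 0) (if (2::nat) < 4 then e 2 else 0) (if (3::nat) < 4 then e 3 else 0) \<in> X)"
      by blast
    show thesis by (rule that[OF p(1)]) (simp add: p(2))
  qed
  have "entries ` X = {xs. length xs = 4 \<and> mat4 (xs ! 0) (xs ! 1) (xs ! 2) (xs ! 3) \<in> X}"
  proof safe
    fix A assume "A \<in> X"
    moreover have "mat4 (entries A ! 0) (entries A ! 1) (entries A ! 2) (entries A ! 3) = A"
      by (simp add: entries_def vec_eq_iff forall_2)
    ultimately show "mat4 (entries A ! 0) (entries A ! 1) (entries A ! 2) (entries A ! 3) \<in> X" by simp
    show "length (entries A) = 4" by (simp add: entries_def)
  next
    fix xs :: "complex list"
    assume len: "length xs = 4" and X: "mat4 (xs ! 0) (xs ! 1) (xs ! 2) (xs ! 3) \<in> X"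
    have "xs = entries (mat4 (xs ! 0) (xs ! 1) (xs ! 2) (xs ! 3))"
      using len by (auto simp: entries_def list_eq_iff_nth_eq less_Suc_eq eval_nat_numeral)
    then show "xs \<in> entries ` X" using X by blast
  qed
  then show "definable_mat X"
    unfolding definable_mat_def definable_def using p by auto
qed

lemma constructible_mem_mat:
  assumes "definable_mat X" "\<And>i j. polyfun (\<lambda>e. A e $ i $ j)"
  shows "constructible (\<lambda>e. A e \<in> X)"
proof -
  have "constructible (\<lambda>e. mat4 (e 0) (e 1) (e 2) (e 3) \<in> X)"
    using assms(1) by (simp add: definable_mat_iff_constructible)
  moreover have "polyfun (\<lambda>e. [A e $ 1 $ 1, A e $ 1 $ 2, A e $ 2 $ 1, A e $ 2 $ 2] ! i)" for i
    by (intro polyfun_nth4 assms(2))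
  ultimately have "constructible (\<lambda>e. (\<lambda>e. mat4 (e 0) (e 1) (e 2) (e 3) \<in> X)
      (\<lambda>i. [A e $ 1 $ 1, A e $ 1 $ 2, A e $ 2 $ 1, A e $ 2 $ 2] ! i))"
    by (rule constructible_subst)
  then
  have "constructible (\<lambda>e. mat4 (A e $ 1 $ 1) (A e $ 1 $ 2) (A e $ 2 $ 1) (A e $ 2 $ 2) \<in> X)" by simp
  moreover have "mat4 (A e $ 1 $ 1) (A e $ 1 $ 2) (A e $ 2 $ 1) (A e $ 2 $ 2) = A e" for e
    by (metis mat4_eq_iff)
  ultimately show ?thesis by simp
qed

lemma polyfun_matrix_mult:
  fixes A B :: "(nat \<Rightarrow> complex) \<Rightarrow> complex^2^2"
  assumes "\<And>i j. polyfun (\<lambda>e. A e $ i $ j)" "\<And>i j. polyfun (\<lambda>e. B e $ i $ j)"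
  shows "polyfun (\<lambda>e. (A e ** B e) $ i $ j)"
  unfolding matrix_matrix_mult_def by (simp add: polyfun_sum polyfun_mult assms)

lemma polyfun_mat4:
  assumes "polyfun a" "polyfun b" "polyfun c" "polyfun d"
  shows "polyfun (\<lambda>e. mat4 (a e) (b e) (c e) (d e) $ i $ j)"
  using exhaust_2[of i] exhaust_2[of j] assms by auto

lemma inf_constr_mem_mat:
  assumes "infty_definable_mat M" "\<And>i j. polyfun (\<lambda>e. A e $ i $ j)"
  shows "inf_constr (\<lambda>e. A e \<in> M)"
proof -
  obtain \<U> where U: "small \<U>" "\<U> \<subseteq> Collect definable_mat" "\<Inter>\<U> = M"
    using assms(1) unfolding infty_definable_mat_def intersection_of_def by blast
  show ?thesis
  proof (rule inf_constrI)
    show "(\<lambda>U e. A e \<in> U) ` \<U> \<prec> (UNIV :: complex set)"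
      using U(1) unfolding small_def by (rule image_small)
    show "constructible V" if "V \<in> (\<lambda>U e. A e \<in> U) ` \<U>" for V
      using that U(2) constructible_mem_mat[OF _ assms(2)] by auto
    show "A e \<in> M \<longleftrightarrow> (\<forall>V\<in>(\<lambda>U e. A e \<in> U) ` \<U>. V e)" for e
      using U(3) by auto
  qed
qed

section \<open>Monoids that are triangular in a suitable basis\<close>

definition conj_tri :: "complex^2^2 \<Rightarrow> complex^2^2 \<Rightarrow> complex \<Rightarrow> complex \<Rightarrow> complex \<Rightarrow> complex^2^2" where
  "conj_tri g g' a b d = g ** mat4 a b 0 d ** g'"

lemma conj_tri_mult:
  assumes "g' ** g = mat 1"
  shows "conj_tri g g' a b d ** conj_tri g g' a' b' d' = conj_tri g g' (a * a') (a * b' + b * d') (d * d')"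
proof -
  have "conj_tri g g' a b d ** conj_tri g g' a' b' d' =
      g ** (mat4 a b 0 d ** (g' ** g) ** mat4 a' b' 0 d') ** g'"
    by (simp add: conj_tri_def matrix_mul_assoc)
  then show ?thesis using assms by (simp add: conj_tri_def mat4_mult)
qed

lemma polyfun_conj_tri:
  "polyfun f \<Longrightarrow> polyfun g \<Longrightarrow> polyfun h \<Longrightarrow> polyfun (\<lambda>e. conj_tri P P' (f e) (g e) (h e) $ i $ j)"
  unfolding conj_tri_def by (intro polyfun_matrix_mult polyfun_mat4 polyfun_const)

text \<open>Conjugation by a fixed matrix is polynomial in the entries and multiplicative, so the
  triangular result carries over to the given basis.\<close>

lemma conj_tri_hull:
  assumes M: "submonoid M M2" "infty_definable_mat M"
    and g: "g ** g' = mat 1" "g' ** g = mat 1"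
    and tri: "\<And>A. A \<in> M \<Longrightarrow> \<exists>a b d. A = conj_tri g g' a b d"
    and zero: "0 \<in> M" and c: "conj_tri g g' 0 c 0 \<in> M" "c \<noteq> 0"
    and U: "definable_mat U" "M \<subseteq> U"
  shows "\<exists>N. submonoid N M2 \<and> definable_mat N \<and> M \<subseteq> N \<and> N \<subseteq> U"
proof -
  have T_one: "conj_tri g g' 1 0 1 = mat 1"
    using g by (simp add: conj_tri_def mat_1_eq_mat4[symmetric])
  have M_mult: "A ** B \<in> M" if "A \<in> M" "B \<in> M" for A B
    using submonoid.m_closed[OF M(1) that] by (simp add: M2_def)
  have M_one: "mat 1 \<in> M"
    using submonoid.one_closed[OF M(1)] by (simp add: M2_def)
  interpret tri_monoid "\<lambda>a b d. conj_tri g g' a b d \<in> M"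
  proof
    show "conj_tri g g' 1 0 1 \<in> M" using M_one by (simp add: T_one)
    show "conj_tri g g' (a * a') (a * b' + b * d') (d * d') \<in> M"
      if "conj_tri g g' a b d \<in> M" "conj_tri g g' a' b' d' \<in> M" for a b d a' b' d'
      using M_mult[OF that] by (simp add: conj_tri_mult[OF g(2)])
    show "inf_constr (\<lambda>e. conj_tri g g' (e 0) (e 1) (e 2) \<in> M)"
      by (intro inf_constr_mem_mat[OF M(2)] polyfun_conj_tri polyfun_var)
  qed
  have "\<exists>m'. constructible (\<lambda>e. m' (e 0) (e 1) (e 2)) \<and> (\<forall>a b d. conj_tri g g' a b d \<in> M \<longrightarrow> m' a b d) \<and>
    (\<forall>a b d. m' a b d \<longrightarrow> conj_tri g g' a b d \<in> U) \<and> (\<forall>a b d a' b' d'. m' a b d \<longrightarrow> m' a' b' d' \<longrightarrow>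
      m' (a * a') (a * b' + b * d') (d * d'))"
  proof (rule tri_monoid_hull[OF _ _ _ c])
    show "constructible (\<lambda>e. conj_tri g g' (e 0) (e 1) (e 2) \<in> U)"
      by (intro constructible_mem_mat[OF U(1)] polyfun_conj_tri polyfun_var)
    have "conj_tri g g' 0 0 0 = 0"
      by (simp add: conj_tri_def vec_eq_iff forall_2 matrix_matrix_mult_def sum_2)
    then show "conj_tri g g' 0 0 0 \<in> M" using zero by simp
  qed (use U(2) in blast)
  then obtain m' where constr: "constructible (\<lambda>e. m' (e 0) (e 1) (e 2))"
    and mm': "\<And>a b d. conj_tri g g' a b d \<in> M \<Longrightarrow> m' a b d"
    and m'U: "\<And>a b d. m' a b d \<Longrightarrow> conj_tri g g' a b d \<in> U"
    and mult': "\<And>a b d a' b' d'. m' a b d \<Longrightarrow> m' a' b' d' \<Longrightarrow> m' (a * a') (a * b' + b * d') (d * d')"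
    by blast
  define N where "N = {conj_tri g g' a b d | a b d. m' a b d}"
  show ?thesis
  proof (intro exI[of _ N] conjI)
    show "submonoid N M2"
    proof
      show "A \<otimes>\<^bsub>M2\<^esub> B \<in> N" if "A \<in> N" "B \<in> N" for A B
        using that mult' conj_tri_mult[OF g(2)] unfolding N_def M2_def by fastforce
      have "m' 1 0 1" using mm' M_one by (simp add: T_one)
      then have "mat 1 \<in> N" unfolding N_def T_one[symmetric] by blast
      then show "\<one>\<^bsub>M2\<^esub> \<in> N" by (simp add: M2_def)
    qed (simp add: M2_def)
    \<comment> \<open>Membership in \<open>N\<close> is a projection along the three triangular
      entries, hence constructible by quantifier elimination.\<close>
    have "constructible (\<lambda>e. \<exists>a b d. (conj_tri g g' a b d $ 1 $ 1 = e 0 \<and> conj_tri g g' a b d $ 1 $ 2 = e 1 \<and>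
        conj_tri g g' a b d $ 2 $ 1 = e 2 \<and> conj_tri g g' a b d $ 2 $ 2 = e 3) \<and> m' a b d)"
      by (intro constructible_ex constructible_and constructible_eq polyfun_conj_tri polyfun_var
          constructible_subst3[OF constr])
    then show "definable_mat N"
      unfolding definable_mat_iff_constructible N_def mat4_eq_iff[symmetric]
      by (simp add: eq_commute)
    show "M \<subseteq> N" using tri mm' unfolding N_def by blast
    show "N \<subseteq> U" using m'U unfolding N_def by blast
  qed
qed

section \<open>Lines in the plane and the quotient by scalars\<close>

lemma CP1_obtain:
  assumes "v \<in> CP1"
  obtains p q where "p \<noteq> 0 \<or> q \<noteq> 0" "v = {x. p * x $ 2 - q * x $ 1 = 0}"
proof -
  have v: "vec.subspace v" "vec.dim v = 1" using assms by (auto simp: CP1_def)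
  obtain B where B: "B \<subseteq> v" "vec.independent B" "v \<subseteq> vec.span B" "card B = 1"
    using vec.basis_exists[of v] v(2) by metis
  then obtain w where w: "B = {w}" by (auto simp: card_1_singleton_iff)
  have "w \<noteq> 0" using B(2) vec.dependent_zero w by auto
  then have nz: "w $ 1 \<noteq> 0 \<or> w $ 2 \<noteq> 0" by (auto simp: vec_eq_iff forall_2)
  have "v = vec.span {w}" using B v(1) w vec.span_minimal by blast
  \<comment> \<open>The linear form that cuts out the line is the determinant with its spanning
    vector \<open>w\<close>.\<close>
  also have "\<dots> = {x. w $ 1 * x $ 2 - w $ 2 * x $ 1 = 0}"
  proof (rule Set.set_eqI)
    fix x
    have "(\<exists>k. x = k *s w) \<longleftrightarrow> w $ 1 * x $ 2 - w $ 2 * x $ 1 = 0"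
    proof
      assume *: "w $ 1 * x $ 2 - w $ 2 * x $ 1 = 0"
      have "x = (x $ 1 / w $ 1) *s w" if "w $ 1 \<noteq> 0"
        using that * by (simp add: vec_eq_iff forall_2 field_simps)
      moreover have "x = (x $ 2 / w $ 2) *s w" if "w $ 2 \<noteq> 0"
        using that * by (simp add: vec_eq_iff forall_2 field_simps)
      ultimately show "\<exists>k. x = k *s w" using nz by blast
    qed (auto simp: algebra_simps)
    then show "x \<in> vec.span {w} \<longleftrightarrow> x \<in> {x. w $ 1 * x $ 2 - w $ 2 * x $ 1 = 0}"
      by (auto simp: vec.span_singleton)
  qed
  finally show ?thesis using nz that by blast
qed

lemma proj_eqD: "proj A = proj B \<Longrightarrow> \<exists>c. c \<noteq> 0 \<and> A = map_matrix ((*) c) B"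
proof -
  assume "proj A = proj B"
  moreover have "A \<in> proj A"
    unfolding proj_def by (auto intro!: exI[of _ 1] simp: vec_eq_iff)
  ultimately show ?thesis unfolding proj_def by auto
qed

lemma map_matrix_mult_vec: "map_matrix ((*) c) A *v x = c *s (A *v (x :: complex^'n))"
  by (simp add: vec_eq_iff matrix_vector_mult_def sum_distrib_left mult.assoc)

theorem theorem4p17:
  fixes M H S :: "(complex^2^2) set"
    and F G :: "(complex^2) set set"
    and v :: "(complex^2) set"
  assumes "submonoid M M2"
    and "infty_definable_mat M"
    and "H = M \<inter> GL2"
    and "S = M \<inter> M2_0"
    and "F \<subseteq> CP1"
    and "G \<subseteq> CP1"
    and "v \<in> F \<inter> G"
    and "proj ` S = B_set F {v} \<union> B_set {v} G"
  shows "(small intersection_of (\<lambda>N. submonoid N M2 \<and> definable_mat N)) M"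
proof -
  obtain p q where pq: "p \<noteq> 0 \<or> q \<noteq> 0" and v: "v = {x. p * x $ 2 - q * x $ 1 = 0}"
    using CP1_obtain[of v] assms(5,7) by blast
  \<comment> \<open>\<open>perp\<close> is a linear form with zero set \<open>v\<close>, and
    \<open>w\<close> is a spanning vector of \<open>v\<close>.\<close>
  define perp where "perp x = p * x $ 2 - q * x $ 1" for x :: "complex^2"
  define w :: "complex^2" where "w = vector [p, q]"
  have "w \<noteq> 0" using pq by (auto simp: w_def vec_eq_iff forall_2)
  have perp_w: "perp w = 0" by (simp add: perp_def w_def)
  have perp_scale: "perp (c *s x) = c * perp x" for c x by (simp add: perp_def algebra_simps)
  obtain y where y: "perp y \<noteq> 0"
  proof (cases "p = 0")
    case True
    then show ?thesis using that[of "vector [1, 0]"] pq by (simp add: perp_def)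
  next
    case False
    then show ?thesis using that[of "vector [0, 1]"] by (simp add: perp_def)
  qed
  have v_perp: "v = {x. perp x = 0}" by (simp add: v perp_def)
  have M_mult: "A ** B \<in> M" if "A \<in> M" "B \<in> M" for A B
    using submonoid.m_closed[OF assms(1) that] by (simp add: M2_def)

  \<comment> \<open>The singular members are zero or have kernel \<open>v\<close> or image
    \<open>v\<close>; the formulation is insensitive to the scalar lost in the quotient.\<close>
  have singular: "A *v w = 0 \<or> (\<forall>x. perp (A *v x) = 0)" if "A \<in> M" "\<not> invertible A" for A
  proof -
    have "proj A \<in> B_set F {v} \<union> B_set {v} G"
      using that unfolding assms(8)[symmetric] assms(4) M2_0_def by blast
    then consider "proj A = proj 0" | B where "proj A = proj B" "kernel_of B = v"
      | B where "proj A = proj B" "image_of B = v"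
      unfolding B_set_def by blast
    then show ?thesis
    proof cases
      case 1
      then obtain c where "A = map_matrix ((*) c) 0" using proj_eqD by blast
      then show ?thesis by (simp add: map_matrix_mult_vec)
    next
      case 2
      then obtain c where "A = map_matrix ((*) c) B" using proj_eqD by blast
      moreover have "w \<in> kernel_of B" using 2 perp_w by (simp add: v_perp)
      ultimately show ?thesis by (simp add: map_matrix_mult_vec kernel_of_def)
    next
      case 3
      then obtain c where "A = map_matrix ((*) c) B" using proj_eqD by blast
      moreover have "B *v x \<in> v" for x using 3 by (auto simp: image_of_def)
      ultimately show ?thesis by (simp add: map_matrix_mult_vec perp_scale v_perp)
    qed
  qed

  have zero: "0 \<in> M"
  proof -
    have "proj 0 \<in> proj ` S" unfolding assms(8) B_set_def by blast
    then obtain A where "A \<in> S" "proj A = proj 0" by (metis imageE)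
    moreover have "map_matrix ((*) c) 0 = (0 :: complex^2^2)" for c :: complex
      by (simp add: vec_eq_iff)
    ultimately show ?thesis using proj_eqD[of A 0] unfolding assms(4) by auto
  qed

  \<comment> \<open>The outer product of the vector \<open>w\<close> with the form
    \<open>perp\<close>: up to scalars the only rank-one matrix with both image and kernel
    \<open>v\<close>.\<close>
  define n0 where "n0 = mat4 (- p * q) (p * p) (- q * q) (p * q)"
  have n0: "n0 *v x = perp x *s w" for x
    by (simp add: n0_def w_def perp_def vec_eq_iff forall_2 matrix_vector_mult_def sum_2 algebra_simps)
  have "rank n0 = 1"
  proof -
    \<comment> \<open>\<open>u\<close> is the coefficient vector of \<open>perp\<close>; both rows
      of \<open>n0\<close> are multiples of it, and at least one multiple is nonzero.\<close>
    define u :: "complex^2" where "u = vector [- q, p]"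
    have "u \<noteq> 0" using pq by (auto simp: u_def vec_eq_iff forall_2)
    have rows: "rows n0 = {p *s u, q *s u}"
    proof -
      have "row 1 n0 = p *s u" "row 2 n0 = q *s u"
        by (simp_all add: row_def n0_def u_def vec_eq_iff forall_2)
      moreover have "rows n0 = {row 1 n0, row 2 n0}"
      proof -
        have "rows n0 = (\<lambda>i. row i n0) ` UNIV" by (auto simp: rows_def)
        then show ?thesis by (simp add: UNIV_2)
      qed
      ultimately show ?thesis by simp
    qed
    have "vec.span (rows n0) = vec.span {u}"
    proof (rule subset_antisym)
      show "vec.span (rows n0) \<subseteq> vec.span {u}"
        by (intro vec.span_minimal vec.subspace_span) (auto simp: rows vec.span_singleton)
      have "u = inverse p *s (p *s u)" if "p \<noteq> 0" using that by (simp add: vec_eq_iff)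
      moreover have "u = inverse q *s (q *s u)" if "q \<noteq> 0" using that by (simp add: vec_eq_iff)
      ultimately have "u \<in> vec.span (rows n0)"
        using pq unfolding rows by (metis insertI1 insertI2 vec.span_base vec.span_scale)
      then show "vec.span {u} \<subseteq> vec.span (rows n0)"
        by (intro vec.span_minimal) auto
    qed
    then have "rank n0 = vec.dim {u}"
      unfolding row_rank_def_gen by (metis vec.dim_span)
    also have "\<dots> = card {u}"
      using \<open>u \<noteq> 0\<close> by (intro vec.dim_eq_card_independent) (simp add: vec.dependent_single)
    finally show ?thesis by simp
  qed
  moreover have "image_of n0 = v"
  proof
    show "image_of n0 \<subseteq> v" by (auto simp: image_of_def n0 v_perp perp_scale perp_w)
    show "v \<subseteq> image_of n0"
    proof
      fix x assume "x \<in> v"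
      then have *: "p * x $ 2 = q * x $ 1" by (simp add: v)
      have "\<exists>k. x = k *s w"
      proof (cases "p = 0")
        case True
        then have "x = (x $ 2 / q) *s w" using pq * by (simp add: vec_eq_iff forall_2 w_def)
        then show ?thesis ..
      next
        case False
        then have "x = (x $ 1 / p) *s w" using * by (simp add: vec_eq_iff forall_2 w_def field_simps)
        then show ?thesis ..
      qed
      then obtain k where "x = k *s w" ..
      then have "x = n0 *v ((k / perp y) *s y)" using y by (simp add: n0 perp_scale)
      then show "x \<in> image_of n0" unfolding image_of_def by blast
    qed
  qed
  moreover have "kernel_of n0 = v"
    using \<open>w \<noteq> 0\<close> by (auto simp: kernel_of_def n0 v_perp vec.scale_eq_0_iff)
  \<comment> \<open>Since \<open>v\<close> lies in \<open>F\<close>, the pair with image and kernel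
    \<open>v\<close> occurs in the hypothesis, which puts a nonzero multiple of \<open>n0\<close>
    into \<open>M\<close>.\<close>
  ultimately have "proj n0 \<in> proj ` S"
    using assms(7) unfolding assms(8) B_set_def by blast
  then obtain s where "s \<in> S" "proj s = proj n0" by (metis imageE)
  then obtain c where c: "c \<noteq> 0" "map_matrix ((*) c) n0 \<in> M"
    using proj_eqD[of s n0] unfolding assms(4) by auto
  define s where "s = map_matrix ((*) c) n0"
  have s: "s *v x = (c * perp x) *s w" for x
    by (simp add: s_def map_matrix_mult_vec n0 vec_eq_iff)

  \<comment> \<open>For invertible \<open>A\<close>, the product \<open>A ** s ** A\<close> lies in \<open>S\<close> and has image \<open>A v\<close> and kernel
    \<open>A\<^sup>-\<^sup>1 v\<close>, so one of the two is \<open>v\<close>.\<close>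
  have stable: "perp (A *v w) = 0" if A: "A \<in> M" for A
  proof (cases "invertible A")
    case False
    have "perp 0 = 0" by (simp add: perp_def)
    then show ?thesis using singular[OF A False] by metis
  next
    case True
    then obtain B where B: "A ** B = mat 1" "B ** A = mat 1" by (auto simp: invertible_def)
    have AB: "A *v (B *v x) = x" for x using B by (simp add: matrix_vector_mul_assoc)
    have X: "(A ** s ** A) *v x = (c * perp (A *v x)) *s (A *v w)" for x
      by (simp add: matrix_vector_mul_assoc[symmetric] s vec.scale)
    \<comment> \<open>The product kills the nonzero vector \<open>B *v w\<close>, because
      \<open>s\<close> kills \<open>w\<close>.\<close>
    have "\<not> invertible (A ** s ** A)"
    proof
      assume "invertible (A ** s ** A)"
      then obtain C where C: "C ** (A ** s ** A) = mat 1" by (auto simp: invertible_def)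
      have "B *v w = (C ** (A ** s ** A)) *v (B *v w)" by (simp add: C)
      also have "\<dots> = C *v ((A ** s ** A) *v (B *v w))" by (rule matrix_vector_mul_assoc[symmetric])
      also have "\<dots> = 0" by (simp add: X AB perp_w)
      finally have "A *v (B *v w) = 0" by simp
      then show False using \<open>w \<noteq> 0\<close> by (simp add: AB)
    qed
    moreover have "A ** s ** A \<in> M" using A c(2) by (intro M_mult) (auto simp: s_def)
    ultimately consider "(A ** s ** A) *v w = 0" | "\<And>x. perp ((A ** s ** A) *v x) = 0"
      using singular by blast
    then show ?thesis
    proof cases
      case 1
      then have "perp (A *v w) = 0 \<or> A *v w = 0" using c(1) by (simp add: X vec.scale_eq_0_iff)
      then show ?thesis by (auto simp: perp_def)
    next
      case 2
      from 2[of "B *v y"] show ?thesis using y c(1) by (simp add: X AB perp_scale)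
    qed
  qed

  \<comment> \<open>A second basis vector completing \<open>w\<close> to a matrix \<open>g\<close>
    of determinant one, so that the adjugate \<open>g'\<close> is its inverse.\<close>
  obtain r t where rt: "p * t - q * r = 1"
  proof (cases "p = 0")
    case True
    then show ?thesis using that[of 0 "- 1 / q"] pq by simp
  next
    case False
    then show ?thesis using that[of "1 / p" 0] by simp
  qed
  define g where "g = mat4 p r q t"
  define g' where "g' = mat4 t (- r) (- q) p"
  have g: "g ** g' = mat 1" "g' ** g = mat 1"
    using rt by (simp_all add: g_def g'_def mat4_mult mat_1_eq_mat4 mat4_eq_iff algebra_simps)
  have tri: "\<exists>a b d. A = conj_tri g g' a b d" if "A \<in> M" for A
  proof -
    define X where "X = g' ** A ** g"
    \<comment> \<open>The second row of \<open>g'\<close> is the form \<open>perp\<close> and the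
      first column of \<open>g\<close> is \<open>w\<close>, so invariance of \<open>v\<close> is the
      vanishing of the lower-left entry.\<close>
    have "X $ 2 $ 1 = perp (A *v w)"
      by (simp add: X_def g_def g'_def perp_def w_def matrix_matrix_mult_def matrix_vector_mult_def
          sum_2 algebra_simps)
    then have "X = mat4 (X $ 1 $ 1) (X $ 1 $ 2) 0 (X $ 2 $ 2)"
      using stable[OF that] by (simp add: mat4_eq_iff)
    moreover have "A = g ** X ** g'"
    proof -
      have "g ** X ** g' = (g ** g') ** A ** (g ** g')" by (simp add: X_def matrix_mul_assoc)
      then show ?thesis using g by simp
    qed
    ultimately show ?thesis unfolding conj_tri_def by metis
  qed
  have "conj_tri g g' 0 c 0 = s"
    by (simp add: conj_tri_def g_def g'_def s_def n0_def mat4_mult vec_eq_iff forall_2)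
  then have nil: "conj_tri g g' 0 c 0 \<in> M" using c(2) by (simp add: s_def)

  obtain \<U> where U: "small \<U>" "\<U> \<subseteq> Collect definable_mat" "\<Inter>\<U> = M"
    using assms(2) unfolding infty_definable_mat_def intersection_of_def by blast
  have "\<exists>N. submonoid N M2 \<and> definable_mat N \<and> M \<subseteq> N \<and> N \<subseteq> U" if "U \<in> \<U>" for U
    using that U(2,3) by (intro conj_tri_hull[OF assms(1,2) g tri zero nil c(1)]) auto
  \<comment> \<open>Choosing one monoid for each member of the family keeps the new family small,
    and its intersection is squeezed between \<open>M\<close> and the old one.\<close>
  then obtain N where N: "\<And>U. U \<in> \<U> \<Longrightarrow> submonoid (N U) M2 \<and> definable_mat (N U) \<and> M \<subseteq> N U \<and> N U \<subseteq> U"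
    by metis
  show ?thesis
    unfolding intersection_of_def
  proof (intro exI[of _ "N ` \<U>"] conjI)
    show "small (N ` \<U>)" using U(1) unfolding small_def by (rule image_small)
    show "N ` \<U> \<subseteq> {N. submonoid N M2 \<and> definable_mat N}" using N by blast
    show "\<Inter> (N ` \<U>) = M" using N U(3) by blast
  qed
qed

end
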